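(* Consider the online matching problem with $d$ resources and request distribution $F$ supported on a finite set of reward vectors $\{\mathbf r_1,\dots,\mathbf r_n\}$ with $\mathbf r_j\in[0,1]^d$ for all $j\in\{1,\dots,n\}$. Fix $\eta>2$ and $\nu>0$, and assume the number of sample paths drawn by RAMS at time $t$ satisfies $K_t\ge(T-t+1)^{\eta+\nu}$. Then there is a constant $C\equiv C(F,\eta,\nu)<\infty$ such that for all $T\in\mathbb N$ and all budgets $B\in\mathbb R^d_{\ge0}$, $$\mathrm{Regret}(B,T;\mathrm{RAMS})\le C.$$
   Context: Online matching (order fulfillment) problem: $d$ resources with initial budget $B\in\mathbb R^d_{\ge0}$, known horizon $T$. Requests $\theta_1,\dots,\theta_T$ are i.i.d. from $F$; a request $\theta$ is a reward vector $\mathbf r_\theta\in[0,1]^d$. Actions are $\mathcal A=\{a_0,a_1,\dots,a_d\}$: $a_0$ rejects ($r(\theta,a_0)=0$, $c(\theta,a_0)=\mathbf0$); $a_k$ matches the request to resource $k$, with $r(\theta,a_k)=\mathbf r_{\theta,k}$ and $c(\theta,a_k)=\mathbf e_k$ (the $k$-th unit vector). At time $t$, after observing $\theta_t$, an action $a_t$ with $B_t-c(\theta_t,a_t)\ge\mathbf0$ is chosen; $B_1=B$, $B_{t+1}=B_t-c(\theta_t,a_t)$. Policies are non-anticipating and may be randomized. Let $V_t^{\mathrm{hs}}(b;\boldsymbol\theta_{\ge t})=\max\{\sum_{k=t}^Tr(\theta_k,a_k):a_k\in\mathcal A,\ \sum_{k=t}^Tc(\theta_k,a_k)\le b\}$,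 $V_{T+1}^{\mathrm{hs}}\equiv0$. $\mathrm{Regret}(B,T;\pi)=\mathbb E[V_1^{\mathrm{hs}}(B;\boldsymbol\theta_{\ge1})]-\mathbb E[\sum_tr(\theta_t,a_t^\pi)]$. RAMS: at each $t$, observe $\theta_t$, draw $K_t$ independent simulated futures $\tilde{\boldsymbol\theta}^{(i)}_{\ge t+1}$, each consisting of $T-t$ i.i.d. requests from $F$, and take the feasible action $a$ maximizing $K_t^{-1}\sum_{i=1}^{K_t}\big[r(\theta_t,a)+V_{t+1}^{\mathrm{hs}}(B_t-c(\theta_t,a);\tilde{\boldsymbol\theta}^{(i)}_{\ge t+1})\big]$. All parameters of $F$ (including $d$) are fixed and do not scale with $T$ or $B$. *)

theory Defs
  imports "HOL-Probability.Probability"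
begin

text \<open>
  Resources are the elements of the finite type \<open>'d\<close>, requests are reward vectors.
  The action \<open>None\<close> rejects, \<open>Some k\<close> matches the request to resource \<open>k\<close>.
\<close>

type_synonym 'd request = "real ^ 'd"
type_synonym 'd action = "'d option"

text \<open>The requests and actions of the periods so far, oldest first.\<close>
type_synonym 'd history = "('d request \<times> 'd action) list"

text \<open>A possibly randomized, non-anticipating policy; its second argument is the current request.\<close>
type_synonym 'd policy = "'d history \<Rightarrow> 'd request \<Rightarrow> 'd action pmf"

fun reward :: "'d::finite request \<Rightarrow> 'd action \<Rightarrow> real" where
  "reward \<theta> None = 0"
| "reward \<theta> (Some k) = \<theta> $ k"

fun cost :: "'d::finite action \<Rightarrow> real ^ 'd" where
  "cost None = 0"
| "cost (Some k) = axis k 1"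

definition feasible :: "real ^ 'd \<Rightarrow> 'd::finite action \<Rightarrow> bool" where
  "feasible b a \<longleftrightarrow> 0 \<le> b - cost a"

text \<open>
  The list \<open>\<theta>s\<close> holds the requests of the remaining periods, so the time index of
  the hindsight value is implicit in its length. For \<open>0 \<le> b\<close> the set is finite and
  nonempty (reject everything), and the value of the empty list is 0.
\<close>
definition V_hs :: "real ^ 'd \<Rightarrow> 'd::finite request list \<Rightarrow> real" where
  "V_hs b \<theta>s = Max {(\<Sum>k<length \<theta>s. reward (\<theta>s ! k) (as ! k)) | as.
      length as = length \<theta>s \<and> (\<Sum>k<length \<theta>s. cost (as ! k)) \<le> b}"

definition remaining :: "real ^ 'd \<Rightarrow> 'd::finite history \<Rightarrow> real ^ 'd" where
  "remaining B h = B - (\<Sum>(\<theta>, a)\<leftarrow>h. cost a)"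

primrec run :: "'d::finite request pmf \<Rightarrow> 'd policy \<Rightarrow> nat \<Rightarrow> 'd history pmf" where
  "run F \<pi> 0 = return_pmf []"
| "run F \<pi> (Suc n) =
     bind_pmf (run F \<pi> n) (\<lambda>h.
     bind_pmf F (\<lambda>\<theta>.
     map_pmf (\<lambda>a. h @ [(\<theta>, a)]) (\<pi> h \<theta>)))"

definition regret :: "'d::finite request pmf \<Rightarrow> real ^ 'd \<Rightarrow> nat \<Rightarrow> 'd policy \<Rightarrow> real" where
  "regret F B T \<pi> =
     measure_pmf.expectation (replicate_pmf T F) (\<lambda>\<theta>s. V_hs B \<theta>s)
     - measure_pmf.expectation (run F \<pi> T) (\<lambda>h. \<Sum>(\<theta>, a)\<leftarrow>h. reward \<theta> a)"

text \<open>
  The simulated average of an action: \<open>b\<close> is the current budget, \<open>\<theta>\<close> the current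
  request and \<open>\<omega> ! i\<close>, for \<open>i < K\<close>, the simulated futures.
\<close>
definition rams_score ::
    "nat \<Rightarrow> real ^ 'd \<Rightarrow> 'd::finite request \<Rightarrow> 'd request list list \<Rightarrow> 'd action \<Rightarrow> real" where
  "rams_score K b \<theta> \<omega> a =
     1 / real K * (\<Sum>i<K. reward \<theta> a + V_hs (b - cost a) (\<omega> ! i))"

text \<open>
  Ties between maximizing actions may be broken arbitrarily, possibly at random and depending
  on the history. A selection rule \<open>\<sigma>\<close> is unconstrained on histories that overspend the budget,
  where no action is feasible and no selection could be valid; these have probability zero.
  Periods are numbered from 1, so the period following \<open>h\<close> is \<open>Suc (length h)\<close>.
\<close>
definition rams_selection ::
    "real ^ 'd \<Rightarrow> (nat \<Rightarrow> nat) \<Rightarrow>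
     ('d::finite history \<Rightarrow> 'd request \<Rightarrow> 'd request list list \<Rightarrow> 'd action pmf) \<Rightarrow> bool" where
  "rams_selection B K \<sigma> \<longleftrightarrow>
     (\<forall>h \<theta> \<omega>. 0 \<le> remaining B h \<longrightarrow>
        set_pmf (\<sigma> h \<theta> \<omega>) \<subseteq>
          {a. is_arg_max (rams_score (K (Suc (length h))) (remaining B h) \<theta> \<omega>)
                (feasible (remaining B h)) a})"

definition rams ::
    "'d::finite request pmf \<Rightarrow> nat \<Rightarrow> (nat \<Rightarrow> nat) \<Rightarrow>
     ('d history \<Rightarrow> 'd request \<Rightarrow> 'd request list list \<Rightarrow> 'd action pmf) \<Rightarrow> 'd policy" where
  "rams F T K \<sigma> h \<theta> =
     (let t = Suc (length h)
      in bind_pmf (replicate_pmf (K t) (replicate_pmf (T - t) F)) (\<lambda>\<omega>. \<sigma> h \<theta> \<omega>))"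

end

theory Submission
  imports Defs
begin

text \<open>
  The regret is split into the losses of the single decisions. Replacing the hindsight optimum by
  the policy one period at a time, the decision taken with \<open>n\<close> periods to come contributes the
  expected gap between the hindsight value before it and the reward plus the hindsight value after
  it (\<open>regret_le_sum_decision_losses\<close>). It suffices to bound this gap, uniformly in the budget, by
  a summable function of \<open>n\<close>. The gap of the action selected by RAMS has two sources.

  First, even the best action chosen before the future is known has a gap, but this is
  exponentially small in \<open>n\<close> (\<open>near_optimal_action\<close>). The hindsight problem depends on the requests
  only through their multiplicities and is an integer program with a fixed number of variables.
  Its optima are Lipschitz in the multiplicities, with a constant that depends neither on the
  budget nor on the horizon (\<open>ip_optimum_sensitivity\<close>, \<open>optimal_allocation_stable\<close>). In an optimal
  plan for the expected multiplicities, the most frequent action for the type of the current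
  request is used linearly often in \<open>n\<close>. By Hoeffding's inequality the actual multiplicities
  deviate by more than a small multiple of \<open>n\<close> only with exponentially small probability.
  Otherwise stability leaves this action in use in an optimal plan for the actual future, so that
  taking it for the current request loses nothing (\<open>used_action_is_optimal\<close>).

  Second, RAMS compares actions by averages over \<open>K\<close> samples. The future value that an action
  costs lies between zero and one, because one unit of a resource is worth at most one
  (\<open>V_hs_budget_bounds\<close>); hence the sampling error is of order \<open>1 / sqrt K\<close>
  (\<open>rams_decision_loss\<close>). With \<open>K\<close> at least \<open>(n + 1) powr (\<eta> + \<nu>)\<close> and \<open>\<eta> + \<nu> > 2\<close>
  these errors are summable over \<open>n\<close>.
\<close>

section \<open>Integer programs under perturbation of the right-hand side\<close>

text \<open>
  A monotone subsequence exists by Ramsey; if it descends, it is eventually constant because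
  \<open>nat\<close> is well-founded.
\<close>
lemma nat_seq_mono_subseq:
  fixes s :: "nat \<Rightarrow> nat"
  shows "\<exists>\<phi> :: nat \<Rightarrow> nat. strict_mono \<phi> \<and> mono (s \<circ> \<phi>)"
proof -
  obtain f where f: "strict_mono f" "monoseq (\<lambda>n. s (f n))"
    using seq_monosub by blast
  show ?thesis
  proof (cases "mono (s \<circ> f)")
    case True
    with f show ?thesis by blast
  next
    case False
    with f(2) have dec: "s (f n) \<le> s (f m)" if "m \<le> n" for m n
      using that by (auto simp: monoseq_def mono_def)
    define v where "v = (LEAST v. v \<in> range (\<lambda>n. s (f n)))"
    have "v \<in> range (\<lambda>n. s (f n))"
      unfolding v_def by (rule LeastI_ex) blast
    then obtain n0 where n0: "s (f n0) = v" by auto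
    have const: "s (f (n0 + n)) = v" for n
      using dec[of n0 "n0 + n"] n0 by (auto simp: v_def intro!: antisym Least_le)
    have "strict_mono (\<lambda>n. f (n0 + n))"
      using f(1) by (simp add: strict_mono_def)
    moreover have "mono (s \<circ> (\<lambda>n. f (n0 + n)))"
      by (simp add: mono_def const)
    ultimately show ?thesis by blast
  qed
qed

text \<open>
  Dickson's lemma, in the form in which it refutes an unbounded family of counterexamples.
\<close>
lemma dickson:
  fixes w :: "nat \<Rightarrow> 'i \<Rightarrow> nat"
  assumes "finite I"
  shows "\<exists>\<phi> :: nat \<Rightarrow> nat. strict_mono \<phi> \<and> (\<forall>i\<in>I. mono (\<lambda>n. w (\<phi> n) i))"
  using assms
proof (induction I)
  case empty
  have "strict_mono (\<lambda>n::nat. n)" by (simp add: strict_mono_def)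
  then show ?case by blast
next
  case (insert i I)
  then obtain \<phi> :: "nat \<Rightarrow> nat" where \<phi>: "strict_mono \<phi>" "\<forall>i\<in>I. mono (\<lambda>n. w (\<phi> n) i)" by blast
  obtain \<psi> :: "nat \<Rightarrow> nat" where \<psi>: "strict_mono \<psi>" "mono ((\<lambda>n. w (\<phi> n) i) \<circ> \<psi>)"
    using nat_seq_mono_subseq by blast
  have "strict_mono (\<lambda>n. \<phi> (\<psi> n))"
    using \<phi>(1) \<psi>(1) by (simp add: strict_mono_def)
  moreover have "mono (\<lambda>n. w (\<phi> (\<psi> n)) j)" if "j \<in> insert i I" for j
  proof (cases "j = i")
    case True
    with \<psi>(2) show ?thesis by (simp add: o_def)
  next
    case False
    with that \<phi>(2) have "mono (\<lambda>n. w (\<phi> n) j)" by blast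
    with strict_mono_mono[OF \<psi>(1)] show ?thesis by (simp add: mono_def)
  qed
  ultimately show ?case by blast
qed

definition ip_feasible :: "('i \<Rightarrow> 'j \<Rightarrow> int) \<Rightarrow> 'j set \<Rightarrow> ('i \<Rightarrow> int) \<Rightarrow> ('j \<Rightarrow> nat) \<Rightarrow> bool" where
  "ip_feasible A J \<beta> x \<longleftrightarrow> (\<forall>i. (\<Sum>j\<in>J. A i j * int (x j)) = \<beta> i)"

definition ip_optimal ::
    "('i \<Rightarrow> 'j \<Rightarrow> int) \<Rightarrow> 'j set \<Rightarrow> ('j \<Rightarrow> real) \<Rightarrow> ('i \<Rightarrow> int) \<Rightarrow> ('j \<Rightarrow> nat) \<Rightarrow> bool" where
  "ip_optimal A J c \<beta> x \<longleftrightarrow> ip_feasible A J \<beta> x \<and>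
     (\<forall>y. ip_feasible A J \<beta> y \<longrightarrow> (\<Sum>j\<in>J. c j * real (y j)) \<le> (\<Sum>j\<in>J. c j * real (x j)))"

text \<open>
  For a fixed change \<open>\<delta>\<close> of the right-hand side, optimal solutions move by a bounded amount,
  whatever the right-hand side is. Otherwise there are pairs \<open>(x C, y C)\<close> of optima for which
  every optimum of the perturbed program is farther than \<open>C\<close> from \<open>x C\<close>. By Dickson's lemma two of
  these pairs, \<open>m\<close> and \<open>n\<close>, have comparable displacements: \<open>y m - x m\<close> has the same signs as
  \<open>y n - x n\<close> and is entrywise smaller in modulus, where \<open>n\<close> may be taken at least the distance
  \<open>D\<close> of the first pair. The difference \<open>z\<close> of the displacements lies in the kernel of \<open>A\<close>, and
  both \<open>x n + z\<close> and \<open>y n - z\<close> are nonnegative. Optimality of \<open>x n\<close> says that \<open>z\<close> does not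
  improve the objective, so \<open>y n - z\<close> is optimal as well; but it is only \<open>D\<close> away from \<open>x n\<close>.
  The argument gives no explicit constant.
\<close>
lemma ip_optimum_sensitivity:
  fixes A :: "'i \<Rightarrow> 'j \<Rightarrow> int" and c :: "'j \<Rightarrow> real" and \<delta> :: "'i \<Rightarrow> int"
  assumes J: "finite J"
  shows "\<exists>C::nat. \<forall>\<beta> x y. ip_optimal A J c \<beta> x \<longrightarrow> ip_optimal A J c (\<lambda>i. \<beta> i + \<delta> i) y \<longrightarrow>
    (\<exists>y'. ip_optimal A J c (\<lambda>i. \<beta> i + \<delta> i) y' \<and> (\<Sum>j\<in>J. \<bar>int (y' j) - int (x j)\<bar>) \<le> int C)"
proof (rule ccontr)
  define bad where "bad C \<beta> x y \<longleftrightarrow> ip_optimal A J c \<beta> x \<and> ip_optimal A J c (\<lambda>i. \<beta> i + \<delta> i) y \<and>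
    (\<forall>y'. ip_optimal A J c (\<lambda>i. \<beta> i + \<delta> i) y' \<longrightarrow> \<not> (\<Sum>j\<in>J. \<bar>int (y' j) - int (x j)\<bar>) \<le> int C)"
    for C :: nat and \<beta> x y
  assume "\<not> ?thesis"
  then have "\<not> (\<exists>C. \<forall>\<beta> x y. \<not> bad C \<beta> x y)"
    unfolding bad_def by blast
  then obtain \<beta> x y where bad: "\<And>C. bad C (\<beta> C) (x C) (y C)"
    by metis
  have x: "ip_optimal A J c (\<beta> C) (x C)"
    and y: "ip_optimal A J c (\<lambda>i. \<beta> C i + \<delta> i) (y C)"
    and far: "ip_optimal A J c (\<lambda>i. \<beta> C i + \<delta> i) y' \<Longrightarrow>
      \<not> (\<Sum>j\<in>J. \<bar>int (y' j) - int (x C j)\<bar>) \<le> int C" for C y'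
    using bad[of C] unfolding bad_def by blast+
  \<comment> \<open>positive and negative parts of the displacements, so that Dickson's lemma respects signs\<close>
  define w where "w C = (\<lambda>(s, j). if s then y C j - x C j else x C j - y C j)" for C
  have "finite ((UNIV :: bool set) \<times> J)" using J by simp
  then obtain \<phi> :: "nat \<Rightarrow> nat" where \<phi>: "strict_mono \<phi>"
    "\<forall>i \<in> UNIV \<times> J. mono (\<lambda>n. w (\<phi> n) i)"
    using dickson[of "UNIV \<times> J" w] by blast
  define m where "m = \<phi> 0"
  define D where "D = (\<Sum>j\<in>J. \<bar>int (y m j) - int (x m j)\<bar>)"
  define n where "n = \<phi> (nat D)"
  have "nat D \<le> n"
    unfolding n_def by (rule seq_suble[OF \<phi>(1)])
  then have "D \<le> int n" by linarith
  have w_le: "w m (s, j) \<le> w n (s, j)" if "j \<in> J" for s j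
    using monoD[OF bspec[OF \<phi>(2), of "(s, j)"], of 0 "nat D"] that
    by (simp add: m_def n_def)
  define z where "z j = (int (y n j) - int (x n j)) - (int (y m j) - int (x m j))" for j
  define x' where "x' j = nat (int (x n j) + z j)" for j
  define y' where "y' j = nat (int (y n j) - z j)" for j
  have x'_int: "int (x' j) = int (x n j) + z j" and y'_int: "int (y' j) = int (y n j) - z j"
    if "j \<in> J" for j
    using w_le[OF that, of True] w_le[OF that, of False]
    by (auto simp: w_def x'_def y'_def z_def)
  have feas: "(\<Sum>j\<in>J. A i j * int (x k j)) = \<beta> k i"
    "(\<Sum>j\<in>J. A i j * int (y k j)) = \<beta> k i + \<delta> i" for k i
    using x[of k] y[of k] unfolding ip_optimal_def ip_feasible_def by auto
  have kernel: "(\<Sum>j\<in>J. A i j * z j) = 0" for i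
    using feas[of i m] feas[of i n] by (simp add: z_def algebra_simps sum.distrib sum_subtractf)
  have "ip_feasible A J (\<beta> n) x'"
    using kernel feas by (simp add: ip_feasible_def x'_int distrib_left sum.distrib)
  then have "(\<Sum>j\<in>J. c j * real (x' j)) \<le> (\<Sum>j\<in>J. c j * real (x n j))"
    using x[of n] unfolding ip_optimal_def by blast
  moreover have "real (x' j) = real (x n j) + of_int (z j)"
    and y'_real: "real (y' j) = real (y n j) - of_int (z j)" if "j \<in> J" for j
    using arg_cong[OF x'_int[OF that], of real_of_int]
      arg_cong[OF y'_int[OF that], of real_of_int] by simp_all
  ultimately have "(\<Sum>j\<in>J. c j * of_int (z j)) \<le> 0"
    by (simp add: distrib_left sum.distrib)
  then have "(\<Sum>j\<in>J. c j * real (y n j)) \<le> (\<Sum>j\<in>J. c j * real (y' j))"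
    by (simp add: y'_real right_diff_distrib sum_subtractf)
  moreover have "ip_feasible A J (\<lambda>i. \<beta> n i + \<delta> i) y'"
    using kernel feas by (simp add: ip_feasible_def y'_int right_diff_distrib sum_subtractf)
  ultimately have "ip_optimal A J c (\<lambda>i. \<beta> n i + \<delta> i) y'"
    using y[of n] unfolding ip_optimal_def by (meson order_trans)
  moreover have "(\<Sum>j\<in>J. \<bar>int (y' j) - int (x n j)\<bar>) = D"
    unfolding D_def by (rule sum.cong) (auto simp: y'_int z_def)
  ultimately show False
    using far \<open>D \<le> int n\<close> by metis
qed

section \<open>The hindsight value\<close>

lemma cost_nth: "cost a $ k = (if a = Some k then 1 else 0)"
  by (cases a) (auto simp: axis_def)

lemma cost_nonneg: "0 \<le> cost a"
  by (simp add: less_eq_vec_def cost_nth)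

lemma feasible_None: "0 \<le> b \<Longrightarrow> feasible b None"
  by (simp add: feasible_def)

lemma finite_hindsight_values:
  "finite {(\<Sum>k<length \<theta>s. reward (\<theta>s ! k) (as ! k)) |as.
    length as = length \<theta>s \<and> (\<Sum>k<length \<theta>s. cost (as ! k)) \<le> b}"
proof -
  have "finite {as :: 'a action list. length as = length \<theta>s}"
    using finite_lists_length_eq[of "UNIV :: 'a action set"] by simp
  then show ?thesis
    by (rule finite_subset[rotated, OF finite_imageI]) auto
qed

lemma V_hs_upper:
  assumes "length as = length \<theta>s" "(\<Sum>k<length \<theta>s. cost (as ! k)) \<le> b"
  shows "(\<Sum>k<length \<theta>s. reward (\<theta>s ! k) (as ! k)) \<le> V_hs b \<theta>s"
  unfolding V_hs_def
  by (rule Max_ge[OF finite_hindsight_values]) (use assms in blast)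

lemma V_hs_attained:
  assumes "0 \<le> b"
  shows "\<exists>as. length as = length \<theta>s \<and> (\<Sum>k<length \<theta>s. cost (as ! k)) \<le> b \<and>
    V_hs b \<theta>s = (\<Sum>k<length \<theta>s. reward (\<theta>s ! k) (as ! k))"
proof -
  let ?S = "{(\<Sum>k<length \<theta>s. reward (\<theta>s ! k) (as ! k)) |as.
      length as = length \<theta>s \<and> (\<Sum>k<length \<theta>s. cost (as ! k)) \<le> b}"
  have "finite ?S" by (rule finite_hindsight_values)
  moreover have "?S \<noteq> {}"
    using assms by (auto intro!: exI[of _ "replicate (length \<theta>s) None"])
  ultimately have "V_hs b \<theta>s \<in> ?S"
    unfolding V_hs_def by (rule Max_in)
  then show ?thesis by auto
qed

lemma V_hs_Nil: "0 \<le> b \<Longrightarrow> V_hs b [] = 0"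
  using V_hs_attained[of b "[]"] by simp

text \<open>
  This lemma and \<open>V_hs_Cons_attained\<close> together are the Bellman equation of the hindsight problem;
  everything below about \<open>V_hs\<close> is derived from them by induction over the requests.
\<close>
lemma V_hs_Cons_ge:
  assumes "feasible b a"
  shows "reward \<theta> a + V_hs (b - cost a) \<theta>s \<le> V_hs b (\<theta> # \<theta>s)"
proof -
  from assms obtain as where as: "length as = length \<theta>s"
    "(\<Sum>k<length \<theta>s. cost (as ! k)) \<le> b - cost a"
    "V_hs (b - cost a) \<theta>s = (\<Sum>k<length \<theta>s. reward (\<theta>s ! k) (as ! k))"
    using V_hs_attained unfolding feasible_def by blast
  then have "(\<Sum>k<length (\<theta> # \<theta>s). cost ((a # as) ! k)) \<le> b"
    by (simp add: sum.lessThan_Suc_shift le_diff_eq add.commute del: sum.lessThan_Suc)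
  from V_hs_upper[OF _ this] as show ?thesis
    by (simp add: sum.lessThan_Suc_shift del: sum.lessThan_Suc)
qed

lemma V_hs_Cons_attained:
  assumes "0 \<le> b"
  shows "\<exists>a. feasible b a \<and> V_hs b (\<theta> # \<theta>s) = reward \<theta> a + V_hs (b - cost a) \<theta>s"
proof -
  obtain as' where as': "length as' = length (\<theta> # \<theta>s)"
    "(\<Sum>k<length (\<theta> # \<theta>s). cost (as' ! k)) \<le> b"
    "V_hs b (\<theta> # \<theta>s) = (\<Sum>k<length (\<theta> # \<theta>s). reward ((\<theta> # \<theta>s) ! k) (as' ! k))"
    using V_hs_attained[OF assms] by blast
  then obtain a as where eq: "as' = a # as" by (cases as') auto
  have len: "length as = length \<theta>s" and
    fit: "cost a + (\<Sum>k<length \<theta>s. cost (as ! k)) \<le> b" and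
    val: "V_hs b (\<theta> # \<theta>s) = reward \<theta> a + (\<Sum>k<length \<theta>s. reward (\<theta>s ! k) (as ! k))"
    using as' unfolding eq by (simp_all add: sum.lessThan_Suc_shift del: sum.lessThan_Suc)
  have "0 \<le> (\<Sum>k<length \<theta>s. cost (as ! k))"
    by (intro sum_nonneg cost_nonneg)
  from order_trans[OF add_left_mono[OF this, of "cost a"] fit] have "cost a \<le> b" by simp
  then have feas: "feasible b a" by (simp add: feasible_def)
  have "(\<Sum>k<length \<theta>s. cost (as ! k)) \<le> b - cost a"
    using fit by (simp add: le_diff_eq add.commute)
  from V_hs_upper[OF len this] val V_hs_Cons_ge[OF feas, of \<theta> \<theta>s]
  show ?thesis using feas by (intro exI[of _ a]) auto
qed

lemma feasible_diff_cost:
  assumes "feasible b a" "feasible b a'" "a \<noteq> a'"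
  shows "feasible (b - cost a) a'"
  using assms unfolding feasible_def less_eq_vec_def
  by (auto simp: cost_nth split: if_splits)

text \<open>
  One unit of a resource is worth at most one: the first action that would use this unit can be
  replaced by a rejection.
\<close>
lemma V_hs_budget_bounds:
  assumes "feasible b a" "\<forall>\<theta> \<in> set \<theta>s. \<forall>k. 0 \<le> \<theta> $ k \<and> \<theta> $ k \<le> 1"
  shows "V_hs (b - cost a) \<theta>s \<le> V_hs b \<theta>s \<and> V_hs b \<theta>s \<le> V_hs (b - cost a) \<theta>s + 1"
  using assms
proof (induction \<theta>s arbitrary: b)
  case Nil
  then have "0 \<le> b - cost a" "0 \<le> b"
    using cost_nonneg[of a] by (auto simp: feasible_def)
  then show ?case by (simp add: V_hs_Nil)
next
  case (Cons \<theta> \<theta>s)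
  have r: "0 \<le> reward \<theta> a' \<and> reward \<theta> a' \<le> 1" for a'
    using Cons.prems by (cases a') auto
  have b: "0 \<le> b - cost a" "0 \<le> b"
    using Cons.prems cost_nonneg[of a] by (auto simp: feasible_def)
  show ?case
  proof
    obtain a' where a': "feasible (b - cost a) a'"
      "V_hs (b - cost a) (\<theta> # \<theta>s) = reward \<theta> a' + V_hs (b - cost a - cost a') \<theta>s"
      using V_hs_Cons_attained[OF b(1)] by blast
    have "feasible (b - cost a') a"
      using a'(1) by (simp add: feasible_def algebra_simps)
    moreover have "feasible b a'"
      using add_mono[of 0 "b - cost a - cost a'" 0 "cost a"] a'(1) cost_nonneg[of a]
      by (simp add: feasible_def)
    ultimately have "feasible b a'" "feasible (b - cost a') a" by blast+
    with Cons.IH[of "b - cost a'"] Cons.prems V_hs_Cons_ge[of b a' \<theta> \<theta>s] a'(2)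
    show "V_hs (b - cost a) (\<theta> # \<theta>s) \<le> V_hs b (\<theta> # \<theta>s)"
      by (simp add: algebra_simps)
  next
    obtain a' where a': "feasible b a'"
      "V_hs b (\<theta> # \<theta>s) = reward \<theta> a' + V_hs (b - cost a') \<theta>s"
      using V_hs_Cons_attained[OF b(2)] by blast
    show "V_hs b (\<theta> # \<theta>s) \<le> V_hs (b - cost a) (\<theta> # \<theta>s) + 1"
    proof (cases "a' = a")
      case True
      then show ?thesis
        using a'(2) r[of a'] V_hs_Cons_ge[OF feasible_None[OF b(1)], of \<theta> \<theta>s] by simp
    next
      case False
      with a'(1) Cons.prems have "feasible (b - cost a) a'" "feasible (b - cost a') a"
        using feasible_diff_cost[of b] by auto
      with Cons.IH[of "b - cost a'"] Cons.prems V_hs_Cons_ge[of "b - cost a" a' \<theta> \<theta>s] a'(2)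
      show ?thesis by (simp add: algebra_simps)
    qed
  qed
qed

section \<open>Allocation tables\<close>

text \<open>
  The order of the requests is irrelevant in hindsight. A table \<open>x\<close> records how many requests of
  each type receive each action; this makes the hindsight problem an integer program whose size
  does not depend on the horizon.
\<close>
definition allocation ::
    "'d request set \<Rightarrow> real ^ 'd \<Rightarrow> 'd request multiset \<Rightarrow>
     ('d request \<Rightarrow> 'd::finite action \<Rightarrow> nat) \<Rightarrow> bool" where
  "allocation R b M x \<longleftrightarrow>
     (\<forall>r\<in>R. (\<Sum>a\<in>UNIV. x r a) = count M r) \<and>
     (\<forall>k. real (\<Sum>r\<in>R. x r (Some k)) \<le> b $ k)"

definition table_value ::
    "'d request set \<Rightarrow> ('d request \<Rightarrow> 'd::finite action \<Rightarrow> nat) \<Rightarrow> real" where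
  "table_value R x = (\<Sum>r\<in>R. \<Sum>a\<in>UNIV. real (x r a) * reward r a)"

definition optimal_allocation ::
    "'d request set \<Rightarrow> real ^ 'd \<Rightarrow> 'd request multiset \<Rightarrow>
     ('d request \<Rightarrow> 'd::finite action \<Rightarrow> nat) \<Rightarrow> bool" where
  "optimal_allocation R b M x \<longleftrightarrow> allocation R b M x \<and>
     (\<forall>y. allocation R b M y \<longrightarrow> table_value R y \<le> table_value R x)"

lemma allocation_budget_nonneg:
  assumes "allocation R b M x"
  shows "0 \<le> b"
  unfolding less_eq_vec_def
proof
  fix k
  have "0 \<le> real (\<Sum>r\<in>R. x r (Some k))" by (rule of_nat_0_le_iff)
  also have "\<dots> \<le> b $ k" using assms unfolding allocation_def by blast
  finally show "0 $ k \<le> b $ k" by simp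
qed

lemma allocation_step:
  fixes x x' :: "'d request \<Rightarrow> 'd::finite action \<Rightarrow> nat"
  assumes "finite R" "\<theta> \<in> R"
    and x: "\<And>r a'. x r a' = x' r a' + (if a' = a then if r = \<theta> then 1 else 0 else 0)"
  shows "allocation R b (add_mset \<theta> M) x \<longleftrightarrow> allocation R (b - cost a) M x'" (is ?A)
    and "table_value R x = table_value R x' + reward \<theta> a" (is ?B)
proof -
  have row: "(\<Sum>a'\<in>UNIV. x r a') = (\<Sum>a'\<in>UNIV. x' r a') + (if r = \<theta> then 1 else 0)" for r
    unfolding x sum.distrib by simp
  have col: "(\<Sum>r\<in>R. x r a') = (\<Sum>r\<in>R. x' r a') + (if a' = a then 1 else 0)" for a'
    unfolding x sum.distrib using assms(1,2) by simp
  show ?A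
    unfolding allocation_def row col by (auto simp: cost_nth algebra_simps split: if_splits)
  have "(\<Sum>a'\<in>UNIV. real (x r a') * reward r a') =
      (\<Sum>a'\<in>UNIV. real (x' r a') * reward r a') + (if r = \<theta> then reward \<theta> a else 0)" for r
  proof -
    have "real (x r a') * reward r a' = real (x' r a') * reward r a' +
        (if a' = a then if r = \<theta> then reward \<theta> a else 0 else 0)" for a'
      by (simp add: x algebra_simps)
    then show ?thesis by (simp add: sum.distrib)
  qed
  then show ?B
    using assms(1,2) by (simp add: table_value_def sum.distrib)
qed

lemma allocation_of_V_hs:
  fixes R :: "'d::finite request set"
  assumes "finite R" "set \<theta>s \<subseteq> R" "0 \<le> b"
  shows "\<exists>x. allocation R b (mset \<theta>s) x \<and> table_value R x = V_hs b \<theta>s"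
  using assms(2,3)
proof (induction \<theta>s arbitrary: b)
  case Nil
  then show ?case
    by (intro exI[of _ "\<lambda>_ _. 0"])
       (auto simp: allocation_def table_value_def V_hs_Nil less_eq_vec_def)
next
  case (Cons \<theta> \<theta>s)
  obtain a where a: "feasible b a" "V_hs b (\<theta> # \<theta>s) = reward \<theta> a + V_hs (b - cost a) \<theta>s"
    using V_hs_Cons_attained Cons.prems by blast
  then obtain x' where x': "allocation R (b - cost a) (mset \<theta>s) x'"
    "table_value R x' = V_hs (b - cost a) \<theta>s"
    using Cons.IH[of "b - cost a"] Cons.prems by (auto simp: feasible_def)
  define x where "x r a' = x' r a' + (if a' = a then if r = \<theta> then 1 else 0 else 0)" for r a'
  have "\<theta> \<in> R" using Cons.prems by simp
  from allocation_step[OF assms(1) this x_def] x' a(2)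
  show ?case by (intro exI[of _ x]) auto
qed

lemma table_remove_unit:
  fixes x :: "'d request \<Rightarrow> 'd::finite action \<Rightarrow> nat"
  assumes "x \<theta> a \<ge> 1"
  obtains x' where
    "\<And>r a'. x r a' = x' r a' + (if a' = a then if r = \<theta> then 1 else 0 else 0)"
  using assms
  by (intro that[of "\<lambda>r a'. x r a' - (if a' = a then if r = \<theta> then 1 else 0 else 0)"]) auto

lemma table_value_le_V_hs:
  fixes R :: "'d::finite request set"
  assumes "finite R" "set \<theta>s \<subseteq> R" "allocation R b (mset \<theta>s) x"
  shows "table_value R x \<le> V_hs b \<theta>s"
  using assms(2,3)
proof (induction \<theta>s arbitrary: b x)
  case Nil
  then have "table_value R x = 0"
    by (auto simp: allocation_def table_value_def intro!: sum.neutral)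
  with allocation_budget_nonneg[OF Nil(2)] show ?case by (simp add: V_hs_Nil)
next
  case (Cons \<theta> \<theta>s)
  then have \<theta>: "\<theta> \<in> R" by simp
  with Cons.prems have "(\<Sum>a\<in>UNIV. x \<theta> a) = Suc (count (mset \<theta>s) \<theta>)"
    by (auto simp: allocation_def)
  then have "(\<Sum>a\<in>UNIV. x \<theta> a) \<noteq> 0" by simp
  then obtain a where "x \<theta> a \<noteq> 0"
    by (rule sum.not_neutral_contains_not_neutral)
  then have "x \<theta> a \<ge> 1" by simp
  then obtain x' where x': "\<And>r a'. x r a' = x' r a' + (if a' = a then if r = \<theta> then 1 else 0 else 0)"
    by (rule table_remove_unit) blast
  have alloc: "allocation R (b - cost a) (mset \<theta>s) x'"
    using allocation_step(1)[OF assms(1) \<theta> x'] Cons.prems by simp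
  then have "feasible b a"
    unfolding feasible_def by (rule allocation_budget_nonneg)
  from V_hs_Cons_ge[OF this, of \<theta> \<theta>s] Cons.IH[OF _ alloc] Cons.prems
    allocation_step(2)[OF assms(1) \<theta> x']
  show ?case by simp
qed

lemma optimal_allocation_exists:
  fixes R :: "'d::finite request set"
  assumes "finite R" "set_mset M \<subseteq> R" "0 \<le> b"
  shows "\<exists>x. optimal_allocation R b M x"
proof -
  obtain \<theta>s where \<theta>s: "mset \<theta>s = M" using ex_mset by blast
  with assms(2) have "set \<theta>s \<subseteq> R" by auto
  then obtain x where "allocation R b M x" "table_value R x = V_hs b \<theta>s"
    using allocation_of_V_hs[OF assms(1) _ assms(3), of \<theta>s] \<theta>s by blast
  moreover have "table_value R y \<le> V_hs b \<theta>s" if "allocation R b M y" for y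
    using table_value_le_V_hs[OF assms(1) \<open>set \<theta>s \<subseteq> R\<close>] that \<theta>s by blast
  ultimately show ?thesis unfolding optimal_allocation_def by auto
qed

lemma used_action_feasible:
  fixes R :: "'d::finite request set"
  assumes "finite R" "allocation R b M x" "\<theta> \<in> R" "x \<theta> a \<ge> 1"
  shows "feasible b a"
  unfolding feasible_def less_eq_vec_def
proof
  fix k
  have "0 \<le> b $ k"
    using allocation_budget_nonneg[OF assms(2)] by (simp add: less_eq_vec_def)
  moreover have "1 \<le> b $ k" if "a = Some k"
  proof -
    have "1 \<le> (\<Sum>r\<in>R. x r (Some k))"
      using member_le_sum[OF assms(3), of "\<lambda>r. x r (Some k)"] assms(1,4) that by simp
    then have "1 \<le> real (\<Sum>r\<in>R. x r (Some k))" by linarith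
    also have "\<dots> \<le> b $ k" using assms(2) unfolding allocation_def by blast
    finally show ?thesis .
  qed
  ultimately show "0 $ k \<le> (b - cost a) $ k" by (simp add: cost_nth)
qed

text \<open>
  Compensated coupling: as soon as some optimal hindsight plan serves a request of type \<open>\<theta>\<close> by
  \<open>a\<close>, the plan may serve the current request that way, and choosing \<open>a\<close> costs nothing.
\<close>
lemma used_action_is_optimal:
  fixes R :: "'d::finite request set"
  assumes "finite R" "set (\<theta> # \<theta>s) \<subseteq> R"
    and x: "optimal_allocation R b (mset (\<theta> # \<theta>s)) x" and "x \<theta> a \<ge> 1"
  shows "V_hs b (\<theta> # \<theta>s) \<le> reward \<theta> a + V_hs (b - cost a) \<theta>s"
proof -
  have \<theta>: "\<theta> \<in> R" and \<theta>s: "set \<theta>s \<subseteq> R" using assms(2) by auto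
  obtain x' where x': "\<And>r a'. x r a' = x' r a' + (if a' = a then if r = \<theta> then 1 else 0 else 0)"
    using assms(4) by (rule table_remove_unit) blast
  have x_alloc: "allocation R b (mset (\<theta> # \<theta>s)) x"
    using x by (simp add: optimal_allocation_def)
  then have alloc: "allocation R (b - cost a) (mset \<theta>s) x'"
    using allocation_step(1)[OF assms(1) \<theta> x'] by simp
  obtain y where "allocation R b (mset (\<theta> # \<theta>s)) y" "table_value R y = V_hs b (\<theta> # \<theta>s)"
    using allocation_of_V_hs[OF assms(1,2) allocation_budget_nonneg[OF x_alloc]] by blast
  with x have "V_hs b (\<theta> # \<theta>s) \<le> table_value R x"
    unfolding optimal_allocation_def by force
  with table_value_le_V_hs[OF assms(1) \<theta>s alloc] allocation_step(2)[OF assms(1) \<theta> x']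
  show "V_hs b (\<theta> # \<theta>s) \<le> reward \<theta> a + V_hs (b - cost a) \<theta>s" by simp
qed

section \<open>Stability of optimal allocations under additional requests\<close>

text \<open>
  The integer program of the tables in equality form: one row constraint for each request type, one
  column constraint for each resource, and a slack variable \<open>Inr k\<close> for the unused units of
  resource \<open>k\<close>. Budgets are rounded down, which changes nothing for integral tables.
\<close>
type_synonym 'd var = "('d request \<times> 'd action) + 'd"

definition alloc_vars :: "'d request set \<Rightarrow> 'd var set" where
  "alloc_vars R = (R \<times> UNIV) <+> UNIV"

definition alloc_matrix :: "'d request + 'd \<Rightarrow> 'd var \<Rightarrow> int" where
  "alloc_matrix i j = (case i of
     Inl r \<Rightarrow> (case j of Inl (r', a) \<Rightarrow> of_bool (r' = r) | Inr k' \<Rightarrow> 0)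
   | Inr k \<Rightarrow> (case j of Inl (r', a) \<Rightarrow> of_bool (a = Some k) | Inr k' \<Rightarrow> of_bool (k' = k)))"

definition alloc_rhs ::
    "'d request set \<Rightarrow> real ^ 'd::finite \<Rightarrow> 'd request multiset \<Rightarrow> 'd request + 'd \<Rightarrow> int" where
  "alloc_rhs R b M i = (case i of Inl r \<Rightarrow> if r \<in> R then int (count M r) else 0 | Inr k \<Rightarrow> \<lfloor>b $ k\<rfloor>)"

definition alloc_reward :: "'d::finite var \<Rightarrow> real" where
  "alloc_reward j = (case j of Inl (r, a) \<Rightarrow> reward r a | Inr k \<Rightarrow> 0)"

definition table_to_ip ::
    "'d request set \<Rightarrow> real ^ 'd::finite \<Rightarrow> ('d request \<Rightarrow> 'd action \<Rightarrow> nat) \<Rightarrow> 'd var \<Rightarrow> nat" where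
  "table_to_ip R b x j = (case j of Inl (r, a) \<Rightarrow> x r a
     | Inr k \<Rightarrow> nat (\<lfloor>b $ k\<rfloor> - int (\<Sum>r\<in>R. x r (Some k))))"

definition ip_to_table :: "('d var \<Rightarrow> nat) \<Rightarrow> 'd request \<Rightarrow> 'd action \<Rightarrow> nat" where
  "ip_to_table X r a = X (Inl (r, a))"

lemma ip_to_table_to_ip: "ip_to_table (table_to_ip R b x) = x"
  by (simp add: fun_eq_iff ip_to_table_def table_to_ip_def)

lemma sum_alloc_vars:
  fixes f :: "'d::finite var \<Rightarrow> 'b::comm_monoid_add"
  assumes "finite R"
  shows "(\<Sum>j\<in>alloc_vars R. f j) =
    (\<Sum>r\<in>R. \<Sum>a\<in>UNIV. f (Inl (r, a))) + (\<Sum>k\<in>UNIV. f (Inr k))"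
  using assms by (simp add: alloc_vars_def sum.Plus sum.cartesian_product)

lemma ip_feasible_alloc_iff:
  fixes X :: "'d::finite var \<Rightarrow> nat"
  assumes "finite R"
  shows "ip_feasible alloc_matrix (alloc_vars R) (alloc_rhs R b M) X \<longleftrightarrow>
    (\<forall>r\<in>R. (\<Sum>a\<in>UNIV. ip_to_table X r a) = count M r) \<and>
    (\<forall>k. int (\<Sum>r\<in>R. ip_to_table X r (Some k)) + int (X (Inr k)) = \<lfloor>b $ k\<rfloor>)"
proof -
  have row: "(\<Sum>j\<in>alloc_vars R. alloc_matrix (Inl r) j * int (X j)) =
      (if r \<in> R then int (\<Sum>a\<in>UNIV. ip_to_table X r a) else 0)" for r
  proof -
    have "(\<Sum>j\<in>alloc_vars R. alloc_matrix (Inl r) j * int (X j)) =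
        (\<Sum>r'\<in>R. \<Sum>a\<in>UNIV. of_bool (r' = r) * int (X (Inl (r', a))))"
      by (simp add: sum_alloc_vars[OF assms] alloc_matrix_def)
    also have "\<dots> = (\<Sum>r'\<in>R. if r' = r then \<Sum>a\<in>UNIV. int (X (Inl (r', a))) else 0)"
      by (intro sum.cong) auto
    finally show ?thesis
      using assms by (simp add: ip_to_table_def)
  qed
  have col: "(\<Sum>j\<in>alloc_vars R. alloc_matrix (Inr k) j * int (X j)) =
      int (\<Sum>r\<in>R. ip_to_table X r (Some k)) + int (X (Inr k))" for k
  proof -
    have "(\<Sum>j\<in>alloc_vars R. alloc_matrix (Inr k) j * int (X j)) =
        (\<Sum>r\<in>R. \<Sum>a\<in>UNIV. if a = Some k then int (X (Inl (r, a))) else 0) +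
        (\<Sum>k'\<in>UNIV. if k' = k then int (X (Inr k')) else 0)"
      unfolding sum_alloc_vars[OF assms]
      by (intro arg_cong2[where f = "(+)"] sum.cong) (auto simp: alloc_matrix_def)
    then show ?thesis by (simp add: ip_to_table_def)
  qed
  show ?thesis
    unfolding ip_feasible_def alloc_rhs_def
  proof (intro iffI conjI ballI allI)
    fix r assume "\<forall>i. (\<Sum>j\<in>alloc_vars R. alloc_matrix i j * int (X j)) =
      (case i of Inl r \<Rightarrow> if r \<in> R then int (count M r) else 0 | Inr k \<Rightarrow> \<lfloor>b $ k\<rfloor>)"
      and "r \<in> R"
    then have "int (\<Sum>a\<in>UNIV. ip_to_table X r a) = int (count M r)"
      using row[of r] by (auto dest!: spec[of _ "Inl r"])
    then show "(\<Sum>a\<in>UNIV. ip_to_table X r a) = count M r" by linarith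
  next
    fix k assume "\<forall>i. (\<Sum>j\<in>alloc_vars R. alloc_matrix i j * int (X j)) =
      (case i of Inl r \<Rightarrow> if r \<in> R then int (count M r) else 0 | Inr k \<Rightarrow> \<lfloor>b $ k\<rfloor>)"
    then show "int (\<Sum>r\<in>R. ip_to_table X r (Some k)) + int (X (Inr k)) = \<lfloor>b $ k\<rfloor>"
      using col[of k] by (auto dest!: spec[of _ "Inr k"])
  next
    fix i assume "(\<forall>r\<in>R. (\<Sum>a\<in>UNIV. ip_to_table X r a) = count M r) \<and>
      (\<forall>k. int (\<Sum>r\<in>R. ip_to_table X r (Some k)) + int (X (Inr k)) = \<lfloor>b $ k\<rfloor>)"
    then show "(\<Sum>j\<in>alloc_vars R. alloc_matrix i j * int (X j)) =
      (case i of Inl r \<Rightarrow> if r \<in> R then int (count M r) else 0 | Inr k \<Rightarrow> \<lfloor>b $ k\<rfloor>)"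
      by (cases i) (simp_all only: row col sum.case, auto)
  qed
qed

lemma ip_feasible_table_to_ip:
  fixes x :: "'d request \<Rightarrow> 'd::finite action \<Rightarrow> nat"
  assumes "finite R" "allocation R b M x"
  shows "ip_feasible alloc_matrix (alloc_vars R) (alloc_rhs R b M) (table_to_ip R b x)"
proof -
  have "int (\<Sum>r\<in>R. x r (Some k)) \<le> \<lfloor>b $ k\<rfloor>" for k
    using assms(2) unfolding allocation_def le_floor_iff by auto
  then show ?thesis
    using assms(2) unfolding ip_feasible_alloc_iff[OF assms(1)] ip_to_table_to_ip
    by (simp add: allocation_def table_to_ip_def)
qed

lemma allocation_ip_to_table:
  fixes X :: "'d::finite var \<Rightarrow> nat"
  assumes "finite R" "ip_feasible alloc_matrix (alloc_vars R) (alloc_rhs R b M) X"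
  shows "allocation R b M (ip_to_table X)"
  unfolding allocation_def
proof (intro conjI allI)
  fix k
  have "int (\<Sum>r\<in>R. ip_to_table X r (Some k)) + int (X (Inr k)) = \<lfloor>b $ k\<rfloor>"
    using assms(2) unfolding ip_feasible_alloc_iff[OF assms(1)] by blast
  then have "int (\<Sum>r\<in>R. ip_to_table X r (Some k)) \<le> \<lfloor>b $ k\<rfloor>" by linarith
  then show "real (\<Sum>r\<in>R. ip_to_table X r (Some k)) \<le> b $ k"
    unfolding le_floor_iff by simp
qed (use assms in \<open>simp add: ip_feasible_alloc_iff\<close>)

lemma ip_value_eq_table_value:
  fixes X :: "'d::finite var \<Rightarrow> nat"
  assumes "finite R"
  shows "(\<Sum>j\<in>alloc_vars R. alloc_reward j * real (X j)) = table_value R (ip_to_table X)"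
  by (simp add: sum_alloc_vars[OF assms] alloc_reward_def table_value_def ip_to_table_def mult.commute)

lemma ip_optimal_table_to_ip:
  fixes x :: "'d request \<Rightarrow> 'd::finite action \<Rightarrow> nat"
  assumes "finite R" "optimal_allocation R b M x"
  shows "ip_optimal alloc_matrix (alloc_vars R) alloc_reward (alloc_rhs R b M) (table_to_ip R b x)"
  using assms ip_feasible_table_to_ip[OF assms(1)] allocation_ip_to_table[OF assms(1)]
  unfolding optimal_allocation_def ip_optimal_def ip_value_eq_table_value[OF assms(1)]
    ip_to_table_to_ip by blast

lemma optimal_allocation_ip_to_table:
  fixes X :: "'d::finite var \<Rightarrow> nat"
  assumes "finite R"
    and X: "ip_optimal alloc_matrix (alloc_vars R) alloc_reward (alloc_rhs R b M) X"
  shows "optimal_allocation R b M (ip_to_table X)"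
  unfolding optimal_allocation_def
proof (intro conjI allI impI)
  show "allocation R b M (ip_to_table X)"
    using X allocation_ip_to_table[OF assms(1)] unfolding ip_optimal_def by blast
  fix y assume "allocation R b M y"
  from ip_feasible_table_to_ip[OF assms(1) this] X
  show "table_value R y \<le> table_value R (ip_to_table X)"
    unfolding ip_optimal_def ip_value_eq_table_value[OF assms(1)]
    by (auto simp: ip_to_table_to_ip)
qed

lemma optimal_allocation_add_one:
  fixes R :: "'d::finite request set"
  assumes R: "finite R" and r: "r \<in> R"
  shows "\<exists>C::nat. \<forall>b M x. set_mset M \<subseteq> R \<longrightarrow> optimal_allocation R b M x \<longrightarrow>
    (\<exists>y. optimal_allocation R b (add_mset r M) y \<and> (\<forall>r'\<in>R. \<forall>a. x r' a \<le> y r' a + C))"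
proof -
  define \<delta> :: "'d request + 'd \<Rightarrow> int" where "\<delta> i = (if i = Inl r then 1 else 0)" for i
  have fin: "finite (alloc_vars R)"
    using R by (simp add: alloc_vars_def)
  have rhs: "alloc_rhs R b (add_mset r M) = (\<lambda>i. alloc_rhs R b M i + \<delta> i)" for b M
    using r by (auto simp: fun_eq_iff alloc_rhs_def \<delta>_def split: sum.split)
  obtain C where C: "\<And>\<beta> x y. ip_optimal alloc_matrix (alloc_vars R) alloc_reward \<beta> x \<Longrightarrow>
      ip_optimal alloc_matrix (alloc_vars R) alloc_reward (\<lambda>i. \<beta> i + \<delta> i) y \<Longrightarrow>
      \<exists>y'. ip_optimal alloc_matrix (alloc_vars R) alloc_reward (\<lambda>i. \<beta> i + \<delta> i) y' \<and>
        (\<Sum>j\<in>alloc_vars R. \<bar>int (y' j) - int (x j)\<bar>) \<le> int C"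
    using ip_optimum_sensitivity[OF fin, of alloc_matrix alloc_reward \<delta>] by blast
  show ?thesis
  proof (intro exI[of _ C] allI impI)
    fix b M x assume M: "set_mset M \<subseteq> R" and x: "optimal_allocation R b M x"
    have "0 \<le> b"
      using x allocation_budget_nonneg unfolding optimal_allocation_def by blast
    then obtain y where "optimal_allocation R b (add_mset r M) y"
      using optimal_allocation_exists[OF R, of "add_mset r M" b] M r by auto
    from C[OF ip_optimal_table_to_ip[OF R x]
        ip_optimal_table_to_ip[OF R this, unfolded rhs]]
    obtain Y where
      Y: "ip_optimal alloc_matrix (alloc_vars R) alloc_reward (alloc_rhs R b (add_mset r M)) Y" and
      dist: "(\<Sum>j\<in>alloc_vars R. \<bar>int (Y j) - int (table_to_ip R b x j)\<bar>) \<le> int C"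
      unfolding rhs by blast
    have "x r' a \<le> ip_to_table Y r' a + C" if "r' \<in> R" for r' a
    proof -
      have "Inl (r', a) \<in> alloc_vars R" using that by (auto simp: alloc_vars_def)
      from member_le_sum[OF this, of "\<lambda>j. \<bar>int (Y j) - int (table_to_ip R b x j)\<bar>"] fin dist
      have "\<bar>int (Y (Inl (r', a))) - int (x r' a)\<bar> \<le> int C"
        by (simp add: table_to_ip_def)
      then show ?thesis unfolding ip_to_table_def by linarith
    qed
    with optimal_allocation_ip_to_table[OF R Y]
    show "\<exists>y. optimal_allocation R b (add_mset r M) y \<and> (\<forall>r'\<in>R. \<forall>a. x r' a \<le> y r' a + C)"
      by blast
  qed
qed

text \<open>
  The bound for one additional request adds up along a chain of optima, one for each request of
  \<open>U\<close>. Intermediate optima exist because requests can always be rejected.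
\<close>
lemma optimal_allocation_stable:
  fixes R :: "'d::finite request set"
  assumes R: "finite R"
  shows "\<exists>C::nat. \<forall>b M U x. set_mset (M + U) \<subseteq> R \<longrightarrow> optimal_allocation R b M x \<longrightarrow>
    (\<exists>y. optimal_allocation R b (M + U) y \<and> (\<forall>r\<in>R. \<forall>a. x r a \<le> y r a + C * size U))"
proof -
  define P where "P r C \<longleftrightarrow> (\<forall>b M x. set_mset M \<subseteq> R \<longrightarrow> optimal_allocation R b M x \<longrightarrow>
    (\<exists>y. optimal_allocation R b (add_mset r M) y \<and> (\<forall>r'\<in>R. \<forall>a. x r' a \<le> y r' a + C)))"
    for r and C :: nat
  have "\<forall>r\<in>R. \<exists>C. P r C"
    unfolding P_def using optimal_allocation_add_one[OF R] by blast
  then obtain c where c: "\<And>r. r \<in> R \<Longrightarrow> P r (c r)" by metis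
  define C where "C = sum c R"
  have "\<exists>y. optimal_allocation R b (M + U) y \<and> (\<forall>r\<in>R. \<forall>a. x r a \<le> y r a + C * size U)"
    if "set_mset (M + U) \<subseteq> R" "optimal_allocation R b M x" for b M U x
    using that(1)
  proof (induction U)
    case empty
    with that(2) show ?case by (intro exI[of _ x]) simp
  next
    case (add r U)
    then obtain y where y: "optimal_allocation R b (M + U) y"
      "\<And>r a. r \<in> R \<Longrightarrow> x r a \<le> y r a + C * size U" by auto
    have r: "r \<in> R" and "set_mset (M + U) \<subseteq> R" using add.prems by simp_all
    then have "\<exists>y'. optimal_allocation R b (add_mset r (M + U)) y' \<and>
        (\<forall>r'\<in>R. \<forall>a. y r' a \<le> y' r' a + c r)"
      using c[OF r] y(1) unfolding P_def by simp
    then obtain y' where y': "optimal_allocation R b (add_mset r (M + U)) y'"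
      "\<And>r' a. r' \<in> R \<Longrightarrow> y r' a \<le> y' r' a + c r"
      by blast
    have "c r \<le> C"
      unfolding C_def using member_le_sum[OF r, of c] R by simp
    then have "x r' a \<le> y' r' a + C * size (add_mset r U)" if "r' \<in> R" for r' a
      using y(2)[OF that, of a] y'(2)[OF that, of a] by simp
    with y'(1) show ?case by auto
  qed
  then show ?thesis by blast
qed

section \<open>Expectations over finitely supported distributions\<close>

abbreviation expect :: "'a pmf \<Rightarrow> ('a \<Rightarrow> real) \<Rightarrow> real" where
  "expect \<equiv> measure_pmf.expectation"

lemma expect_mono:
  assumes "finite (set_pmf p)" "\<And>x. x \<in> set_pmf p \<Longrightarrow> f x \<le> g x"
  shows "expect p f \<le> expect p g"
  using assms by (intro integral_mono_AE) (auto simp: AE_measure_pmf_iff integrable_measure_pmf_finite)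

lemma expect_cong:
  assumes "\<And>x. x \<in> set_pmf p \<Longrightarrow> f x = g x"
  shows "expect p f = expect p g"
  using assms by (intro integral_cong_AE) (auto simp: AE_measure_pmf_iff)

lemma expect_add:
  "finite (set_pmf p) \<Longrightarrow> expect p (\<lambda>x. f x + g x) = expect p f + expect p g"
  by (simp add: integrable_measure_pmf_finite)

lemma expect_diff:
  "finite (set_pmf p) \<Longrightarrow> expect p (\<lambda>x. f x - g x) = expect p f - expect p g"
  by (simp add: integrable_measure_pmf_finite)

lemma expect_sum:
  "finite (set_pmf p) \<Longrightarrow> expect p (\<lambda>x. \<Sum>i\<in>I. f i x) = (\<Sum>i\<in>I. expect p (f i))"
  by (simp add: integrable_measure_pmf_finite)

lemma expect_const: "expect p (\<lambda>_. c) = c"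
  by simp

lemma expect_bind:
  assumes "finite (set_pmf p)" "\<And>x. x \<in> set_pmf p \<Longrightarrow> finite (set_pmf (f x))"
  shows "expect (bind_pmf p f) h = expect p (\<lambda>x. expect (f x) h)"
proof -
  have "expect (bind_pmf p f) h = (\<Sum>a\<in>set_pmf p. pmf p a *\<^sub>R expect (f a) h)"
    using assms by (intro pmf_expectation_bind) auto
  also have "\<dots> = expect p (\<lambda>x. expect (f x) h)"
    using assms(1) by (subst integral_measure_pmf[of "set_pmf p"]) auto
  finally show ?thesis .
qed

lemma finite_set_replicate_pmf: "finite (set_pmf p) \<Longrightarrow> finite (set_pmf (replicate_pmf n p))"
  unfolding set_replicate_pmf using finite_lists_length_eq[of "set_pmf p" n]
  by (simp add: lists_eq_set conj_commute)

lemma expect_replicate_Suc: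
  assumes "finite (set_pmf p)"
  shows "expect (replicate_pmf (Suc n) p) h = expect p (\<lambda>x. expect (replicate_pmf n p) (\<lambda>xs. h (x # xs)))"
  using assms finite_set_replicate_pmf[OF assms] by (simp add: expect_bind)

text \<open>
  When a sample is added to the sum, the mixed term of the square vanishes by independence.
\<close>
lemma second_moment_sum_list:
  assumes fin: "finite (set_pmf p)" and mean: "expect p g = 0"
  shows "expect (replicate_pmf n p) (\<lambda>xs. sum_list (map g xs)) = 0"
    and "expect (replicate_pmf n p) (\<lambda>xs. (sum_list (map g xs))\<^sup>2) = real n * expect p (\<lambda>x. (g x)\<^sup>2)"
proof (induction n)
  case (Suc n)
  note fin' = finite_set_replicate_pmf[OF fin, of n]
  {
    case 1
    show ?case
      using Suc(1) mean by (simp add: expect_replicate_Suc[OF fin] expect_add[OF fin'] del: replicate_pmf.simps)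
  next
    case 2
    have "expect (replicate_pmf n p) (\<lambda>xs. (g x + sum_list (map g xs))\<^sup>2) =
        (g x)\<^sup>2 + real n * expect p (\<lambda>x. (g x)\<^sup>2)" for x
      using Suc unfolding power2_sum by (simp add: expect_add[OF fin'])
    then show ?case
      by (simp add: expect_replicate_Suc[OF fin] expect_add[OF fin] algebra_simps
          del: replicate_pmf.simps)
  }
qed simp_all

lemma sample_mean_error:
  assumes fin: "finite (set_pmf p)" and bound: "\<And>x. x \<in> set_pmf p \<Longrightarrow> \<bar>f x\<bar> \<le> 1" and "K > 0"
  shows "expect (replicate_pmf K p) (\<lambda>xs. \<bar>1 / real K * (\<Sum>i<K. f (xs ! i)) - expect p f\<bar>) \<le> 1 / sqrt (real K)"
proof -
  define \<mu> where "\<mu> = expect p f"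
  define g where "g x = f x - \<mu>" for x
  define S where "S xs = sum_list (map g xs)" for xs
  note fin' = finite_set_replicate_pmf[OF fin, of K]
  have "expect p g = 0"
    unfolding g_def \<mu>_def by (simp add: expect_diff[OF fin])
  note second = second_moment_sum_list(2)[OF fin this, of K, folded S_def]
  have "expect p (\<lambda>x. (g x)\<^sup>2) = expect p (\<lambda>x. (f x)\<^sup>2 + (\<mu>\<^sup>2 - 2 * \<mu> * f x))"
    by (simp add: g_def power2_diff algebra_simps)
  also have "\<dots> = expect p (\<lambda>x. (f x)\<^sup>2) - \<mu>\<^sup>2"
    by (simp only: expect_add[OF fin] expect_diff[OF fin]) (simp add: \<mu>_def power2_eq_square)
  also have "expect p (\<lambda>x. (f x)\<^sup>2) \<le> expect p (\<lambda>_. 1)"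
    using bound by (intro expect_mono fin) (simp add: abs_square_le_1)
  finally have var: "expect p (\<lambda>x. (g x)\<^sup>2) \<le> 1"
    by simp (meson diff_le_eq le_add_same_cancel1 order_trans zero_le_power2)
  have K: "sqrt (real K) > 0" using assms(3) by simp
  have "expect (replicate_pmf K p) (\<lambda>xs. \<bar>1 / real K * (\<Sum>i<K. f (xs ! i)) - \<mu>\<bar>) =
      expect (replicate_pmf K p) (\<lambda>xs. \<bar>S xs\<bar> / real K)"
  proof (rule expect_cong)
    fix xs assume "xs \<in> set_pmf (replicate_pmf K p)"
    then have "length xs = K" by (simp add: set_replicate_pmf)
    then have "S xs = (\<Sum>i<K. f (xs ! i)) - real K * \<mu>"
      unfolding S_def by (simp add: sum_list_sum_nth g_def sum_subtractf atLeast0LessThan)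
    then have "1 / real K * (\<Sum>i<K. f (xs ! i)) - \<mu> = S xs / real K"
      using assms(3) by (simp add: field_simps)
    then show "\<bar>1 / real K * (\<Sum>i<K. f (xs ! i)) - \<mu>\<bar> = \<bar>S xs\<bar> / real K" by simp
  qed
  also have "\<dots> \<le> expect (replicate_pmf K p) (\<lambda>xs. (S xs)\<^sup>2 / (2 * real K * sqrt (real K)) + 1 / (2 * sqrt (real K)))"
  proof (intro expect_mono fin')
    fix xs
    \<comment> \<open>pointwise substitute for \<open>E \<bar>S\<bar> \<le> sqrt (E S\<^sup>2)\<close>, sharp when \<open>\<bar>S\<bar> = sqrt K\<close>\<close>
    have "0 \<le> (\<bar>S xs\<bar> - sqrt (real K))\<^sup>2" by simp
    then have "2 * \<bar>S xs\<bar> * sqrt (real K) \<le> (S xs)\<^sup>2 + real K"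
      by (simp add: power2_diff)
    then show "\<bar>S xs\<bar> / real K \<le> (S xs)\<^sup>2 / (2 * real K * sqrt (real K)) + 1 / (2 * sqrt (real K))"
      using K assms(3) by (simp add: field_simps)
  qed
  also have "\<dots> = real K * expect p (\<lambda>x. (g x)\<^sup>2) / (2 * real K * sqrt (real K)) + 1 / (2 * sqrt (real K))"
    by (subst expect_add[OF fin']) (simp add: second)
  also have "\<dots> \<le> real K * 1 / (2 * real K * sqrt (real K)) + 1 / (2 * sqrt (real K))"
    using var by (intro add_right_mono divide_right_mono mult_left_mono) auto
  also have "\<dots> = 1 / sqrt (real K)"
    using K assms(3) by (simp add: field_simps)
  finally show ?thesis unfolding \<mu>_def .
qed

lemma count_replicate_pmf:
  "map_pmf (\<lambda>xs. count (mset xs) r) (replicate_pmf n F) = binomial_pmf n (pmf F r)"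
proof (induction n)
  case 0
  show ?case by (simp add: binomial_pmf_0 pmf_le_1)
next
  case (Suc n)
  have bern: "bernoulli_pmf (pmf F r) = map_pmf (\<lambda>x. x = r) F"
  proof (rule pmf_eqI)
    fix v
    have T: "pmf (map_pmf (\<lambda>x. x = r) F) True = pmf F r"
      by (simp add: pmf_map vimage_def measure_pmf_single)
    then show "pmf (bernoulli_pmf (pmf F r)) v = pmf (map_pmf (\<lambda>x. x = r) F) v"
      using pmf_False_conv_True[of "map_pmf (\<lambda>x. x = r) F"]
      by (cases v) (simp_all add: pmf_le_1)
  qed
  show ?case
    by (subst binomial_pmf_Suc)
       (auto simp: pmf_le_1 Suc.IH[symmetric] bern map_pmf_def bind_assoc_pmf bind_return_pmf
        intro!: bind_pmf_cong)
qed

lemma count_lower_tail: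
  assumes "\<epsilon> \<ge> 0"
  shows "measure_pmf.prob (replicate_pmf n F) {xs. real (count (mset xs) r) < (pmf F r - \<epsilon>) * real n}
    \<le> exp (-2 * \<epsilon>\<^sup>2) ^ n"
proof (cases "n = 0")
  case False
  have "measure_pmf.prob (replicate_pmf n F) {xs. real (count (mset xs) r) < (pmf F r - \<epsilon>) * real n} \<le>
      measure_pmf.prob (replicate_pmf n F) {xs. real (count (mset xs) r) / n \<le> pmf F r - \<epsilon>}"
    using False by (intro measure_pmf.finite_measure_mono) (auto simp: field_simps)
  also have "\<dots> = measure_pmf.prob (binomial_pmf n (pmf F r)) {k. real k / n \<le> pmf F r - \<epsilon>}"
    by (simp add: vimage_def flip: count_replicate_pmf)
  also have "\<dots> \<le> exp (-2 * real n * \<epsilon>\<^sup>2)"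
    using binomial_distribution.prob_le'[of "pmf F r" n \<epsilon>] False assms
    by (simp add: binomial_distribution_def pmf_le_1)
  also have "\<dots> = exp (-2 * \<epsilon>\<^sup>2) ^ n"
    by (simp add: exp_of_nat_mult[symmetric] mult_ac)
  finally show ?thesis .
qed simp

lemma atypical_counts_prob:
  assumes "finite (set_pmf F)" "\<epsilon> \<ge> 0"
  shows "measure_pmf.prob (replicate_pmf n F)
      {xs. \<exists>r\<in>set_pmf F. real (count (mset xs) r) < (pmf F r - \<epsilon>) * real n}
    \<le> real (card (set_pmf F)) * exp (-2 * \<epsilon>\<^sup>2) ^ n" (is "measure_pmf.prob _ ?A \<le> _")
proof -
  have "?A = (\<Union>r\<in>set_pmf F. {xs. real (count (mset xs) r) < (pmf F r - \<epsilon>) * real n})" by blast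
  then have "measure_pmf.prob (replicate_pmf n F) ?A \<le> (\<Sum>r\<in>set_pmf F.
      measure_pmf.prob (replicate_pmf n F) {xs. real (count (mset xs) r) < (pmf F r - \<epsilon>) * real n})"
    using measure_pmf.finite_measure_subadditive_finite[OF assms(1)] by simp
  also have "\<dots> \<le> (\<Sum>r\<in>set_pmf F. exp (-2 * \<epsilon>\<^sup>2) ^ n)"
    by (intro sum_mono count_lower_tail assms(2))
  finally show ?thesis by simp
qed

section \<open>The loss of a single decision\<close>

lemma in_set_replicate_pmf:
  "xs \<in> set_pmf (replicate_pmf n p) \<longleftrightarrow> set xs \<subseteq> set_pmf p \<and> length xs = n"
  by (auto simp: set_replicate_pmf)

lemma V_hs_Cons_le:
  assumes "0 \<le> b" "\<forall>r \<in> insert \<theta> (set \<theta>s). \<forall>k. 0 \<le> r $ k \<and> r $ k \<le> 1"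
  shows "V_hs b (\<theta> # \<theta>s) \<le> 1 + V_hs b \<theta>s"
proof -
  obtain a where a: "feasible b a" "V_hs b (\<theta> # \<theta>s) = reward \<theta> a + V_hs (b - cost a) \<theta>s"
    using V_hs_Cons_attained assms(1) by blast
  have "reward \<theta> a \<le> 1" using assms(2) by (cases a) auto
  moreover have "V_hs (b - cost a) \<theta>s \<le> V_hs b \<theta>s"
    using V_hs_budget_bounds[OF a(1)] assms(2) by blast
  ultimately show ?thesis using a(2) by simp
qed

lemma decision_loss_le_2:
  assumes "feasible b a" "\<forall>r \<in> insert \<theta> (set \<theta>s). \<forall>k. 0 \<le> r $ k \<and> r $ k \<le> 1"
  shows "V_hs b (\<theta> # \<theta>s) \<le> reward \<theta> a + V_hs (b - cost a) \<theta>s + 2"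
proof -
  have "0 \<le> b" using assms(1) cost_nonneg[of a] unfolding feasible_def by simp
  from V_hs_Cons_le[OF this assms(2)] V_hs_budget_bounds[OF assms(1), of \<theta>s] assms(2)
  have "V_hs b (\<theta> # \<theta>s) \<le> 1 + (V_hs (b - cost a) \<theta>s + 1)" by force
  moreover have "0 \<le> reward \<theta> a" using assms(2) by (cases a) auto
  ultimately show ?thesis by simp
qed

text \<open>
  If the reference multiset \<open>M\<close> contains many requests of type \<open>\<theta>\<close>, then an optimal plan for \<open>M\<close>
  gives one action to so many of them that this action remains in use in some optimal plan for
  every small enlargement of \<open>M\<close>. The action is chosen from \<open>M\<close> alone, before the future is known.
\<close>
lemma robust_action:
  fixes R :: "'d::finite request set" and C :: nat
  assumes R: "finite R" "set_mset M \<subseteq> R" and \<theta>: "\<theta> \<in> R" and b: "0 \<le> b"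
    and C: "\<And>b M U x. set_mset (M + U) \<subseteq> R \<Longrightarrow> optimal_allocation R b M x \<Longrightarrow>
      \<exists>y. optimal_allocation R b (M + U) y \<and> (\<forall>r\<in>R. \<forall>a. x r a \<le> y r a + C * size U)"
    and large: "CARD('d action) * (C * L) < count M \<theta>"
  obtains a where "feasible b a" "\<And>\<theta>s. set \<theta>s \<subseteq> R \<Longrightarrow> M \<subseteq># mset (\<theta> # \<theta>s) \<Longrightarrow>
      size (mset (\<theta> # \<theta>s) - M) \<le> L \<Longrightarrow>
      V_hs b (\<theta> # \<theta>s) \<le> reward \<theta> a + V_hs (b - cost a) \<theta>s"
proof -
  obtain x where x: "optimal_allocation R b M x"
    using optimal_allocation_exists[OF R b] by blast
  obtain a where a: "C * L < x \<theta> a"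
  proof (rule ccontr)
    assume "\<not> thesis"
    with that have "x \<theta> a \<le> C * L" for a by (meson not_less)
    then have "(\<Sum>a\<in>UNIV. x \<theta> a) \<le> CARD('d action) * (C * L)"
      using sum_bounded_above[of UNIV "x \<theta>" "C * L"] by (simp only: of_nat_id UNIV_I)
    moreover have "(\<Sum>a\<in>UNIV. x \<theta> a) = count M \<theta>"
      using x \<theta> unfolding optimal_allocation_def allocation_def by blast
    ultimately show False using large by simp
  qed
  show thesis
  proof (rule that[of a])
    show "feasible b a"
      using used_action_feasible[OF R(1) _ \<theta>] x a unfolding optimal_allocation_def by fastforce
    fix \<theta>s assume \<theta>s: "set \<theta>s \<subseteq> R" "M \<subseteq># mset (\<theta> # \<theta>s)" "size (mset (\<theta> # \<theta>s) - M) \<le> L"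
    define U where "U = mset (\<theta> # \<theta>s) - M"
    have sum: "M + U = mset (\<theta> # \<theta>s)" unfolding U_def using \<theta>s(2) by simp
    have sub: "set (\<theta> # \<theta>s) \<subseteq> R" using \<theta>s(1) \<theta> by simp
    then have "set_mset (M + U) \<subseteq> R" unfolding sum by simp
    from C[OF this x] obtain y where
      y: "optimal_allocation R b (mset (\<theta> # \<theta>s)) y" "x \<theta> a \<le> y \<theta> a + C * size U"
      using \<theta> unfolding sum by blast
    have "C * size U \<le> C * L" using \<theta>s(3) unfolding U_def by simp
    with a y(2) have "y \<theta> a \<ge> 1" by linarith
    from used_action_is_optimal[OF R(1) sub y(1) this]
    show "V_hs b (\<theta> # \<theta>s) \<le> reward \<theta> a + V_hs (b - cost a) \<theta>s" .
  qed
qed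

lemma multiset_with_counts:
  assumes "finite R"
  obtains M where "\<And>r. count M r = (if r \<in> R then f r else 0)" "set_mset M \<subseteq> R" "size M = sum f R"
proof -
  define M where "M = (\<Sum>r\<in>R. replicate_mset (f r) r)"
  have count: "count M r = (if r \<in> R then f r else 0)" for r
    using assms by (simp add: M_def count_sum)
  have "set_mset M \<subseteq> R"
    using count by (auto simp: count_greater_zero_iff[symmetric] simp del: count_greater_zero_iff split: if_splits)
  moreover have "size M = sum f R"
    unfolding M_def by (simp add: size_multiset_sum)
  ultimately show thesis using count that by blast
qed

text \<open>
  The reference multiset has slightly fewer requests of each type than expected in the future.
  Except with exponentially small probability the actual future exceeds it, by a small multiple of
  the horizon at most, and then the action of \<open>robust_action\<close> is optimal in hindsight. The
  constants are independent of the budget since the stability constant is.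
\<close>
lemma near_optimal_action:
  fixes F :: "'d::finite request pmf"
  assumes fin: "finite (set_pmf F)"
    and unit: "\<And>r k. r \<in> set_pmf F \<Longrightarrow> 0 \<le> r $ k \<and> r $ k \<le> 1"
  shows "\<exists>G \<rho>. 0 < \<rho> \<and> \<rho> < 1 \<and> (\<forall>n b \<theta>. 0 \<le> b \<longrightarrow> \<theta> \<in> set_pmf F \<longrightarrow>
    (\<exists>a. feasible b a \<and>
      expect (replicate_pmf n F) (\<lambda>\<theta>s. V_hs b (\<theta> # \<theta>s)) \<le>
      reward \<theta> a + expect (replicate_pmf n F) (V_hs (b - cost a)) + G * \<rho> ^ n))"
proof -
  define R where "R = set_pmf F"
  define D where "D = real CARD('d action)"
  define m where "m = real (card R)"
  define p where "p = Min (pmf F ` R)"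
  have R: "finite R" "R \<noteq> {}" using fin set_pmf_not_empty by (auto simp: R_def)
  then have p: "p > 0" "\<And>r. r \<in> R \<Longrightarrow> p \<le> pmf F r"
    unfolding p_def by (auto simp: R_def pmf_positive)
  obtain C :: nat where C: "\<And>b M U x. set_mset (M + U) \<subseteq> R \<Longrightarrow> optimal_allocation R b M x \<Longrightarrow>
      \<exists>y. optimal_allocation R b (M + U) y \<and> (\<forall>r\<in>R. \<forall>a. x r a \<le> y r a + C * size U)"
    using optimal_allocation_stable[OF R(1)] by blast
  \<comment> \<open>The choice of \<open>\<epsilon>\<close> makes \<open>D * C * m * \<epsilon> + \<epsilon> = p / 2\<close>: the future exceeds the reference by about
    \<open>m * \<epsilon> * n\<close> requests, so \<open>D\<close> times the displacement of a table entry is about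
    \<open>D * C * m * \<epsilon> * n\<close>, which stays below the number \<open>(p - \<epsilon>) * n\<close> of reference requests of the
    rarest type by \<open>p * n / 2\<close>. For \<open>n > n0\<close> this margin covers the rounding errors.\<close>
  define \<epsilon> where "\<epsilon> = p / (2 * (1 + D * real C * m))"
  define n0 where "n0 = 2 * (2 + D * real C * (1 + m)) / p"
  define \<rho> where "\<rho> = exp (-2 * \<epsilon>\<^sup>2)"
  define G where "G = max (2 * m) (2 / \<rho> ^ nat \<lceil>n0\<rceil>)"
  have D: "D * real C * m \<ge> 0" by (simp add: D_def m_def)
  then have \<epsilon>: "\<epsilon> > 0" using p(1) by (simp add: \<epsilon>_def)
  then have \<rho>: "0 < \<rho>" "\<rho> < 1" by (simp_all add: \<rho>_def)
  have "\<exists>a. feasible b a \<and>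
      expect (replicate_pmf n F) (\<lambda>\<theta>s. V_hs b (\<theta> # \<theta>s)) \<le>
      reward \<theta> a + expect (replicate_pmf n F) (V_hs (b - cost a)) + G * \<rho> ^ n"
    if b: "0 \<le> b" and \<theta>: "\<theta> \<in> R" for n b \<theta>
  proof -
    note fin' = finite_set_replicate_pmf[OF fin, of n]
    have unit': "\<forall>r \<in> insert \<theta> (set \<theta>s). \<forall>k. 0 \<le> r $ k \<and> r $ k \<le> 1"
      if "\<theta>s \<in> set_pmf (replicate_pmf n F)" for \<theta>s
      using that \<theta> unit by (auto simp: in_set_replicate_pmf R_def)
    have reward_out: "expect (replicate_pmf n F) (\<lambda>\<theta>s. reward \<theta> a + V_hs (b - cost a) \<theta>s + c \<theta>s) =
        reward \<theta> a + expect (replicate_pmf n F) (V_hs (b - cost a)) + expect (replicate_pmf n F) c" for a c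
      by (simp add: expect_add[OF fin'])
    show ?thesis
    proof (cases "real n \<le> n0")
      case True
      \<comment> \<open>\<open>G\<close> is so large that the trivial bound 2 suffices for these finitely many \<open>n\<close>\<close>
      then have "n \<le> nat \<lceil>n0\<rceil>" by linarith
      then have "\<rho> ^ nat \<lceil>n0\<rceil> \<le> \<rho> ^ n" using \<rho> by (intro power_decreasing) auto
      moreover have "\<rho> ^ nat \<lceil>n0\<rceil> > 0" using \<rho> by simp
      ultimately have "2 \<le> 2 / \<rho> ^ nat \<lceil>n0\<rceil> * \<rho> ^ n"
        by (simp add: field_simps)
      also have "\<dots> \<le> G * \<rho> ^ n"
        using \<rho> by (intro mult_right_mono) (auto simp: G_def)
      finally have G: "2 \<le> G * \<rho> ^ n" .
      have feas: "feasible b None" using b by (rule feasible_None)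
      have "expect (replicate_pmf n F) (\<lambda>\<theta>s. V_hs b (\<theta> # \<theta>s)) \<le>
          expect (replicate_pmf n F) (\<lambda>\<theta>s. reward \<theta> None + V_hs (b - cost None) \<theta>s + 2)"
        using decision_loss_le_2[OF feas unit'] by (intro expect_mono fin') blast
      then have "expect (replicate_pmf n F) (\<lambda>\<theta>s. V_hs b (\<theta> # \<theta>s)) \<le>
          reward \<theta> None + expect (replicate_pmf n F) (V_hs (b - cost None)) + 2"
        unfolding reward_out expect_const .
      with G feas show ?thesis by (intro exI[of _ None]) linarith
    next
      case False
      define N where "N r = nat \<lfloor>(pmf F r - \<epsilon>) * real n\<rfloor>" for r
      obtain M where M: "\<And>r. count M r = (if r \<in> R then N r else 0)" "set_mset M \<subseteq> R" "size M = sum N R"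
        using multiset_with_counts[OF R(1), of N] by blast
      define L where "L = Suc n - size M"
      have N_ge: "real (N r) \<ge> (pmf F r - \<epsilon>) * real n - 1" for r
        unfolding N_def by linarith
      have "(\<Sum>r\<in>R. pmf F r) = 1"
        using R by (intro sum_pmf_eq_1) (auto simp: R_def)
      then have "real n - m * \<epsilon> * real n - m = (\<Sum>r\<in>R. (pmf F r - \<epsilon>) * real n - 1)"
        by (simp add: sum_subtractf left_diff_distrib m_def mult.assoc flip: sum_distrib_right)
      also have "\<dots> \<le> real (size M)"
        unfolding M(3) of_nat_sum using N_ge by (rule sum_mono)
      finally have size_M: "real n - m * \<epsilon> * real n - m \<le> real (size M)" .
      have "m * \<epsilon> * real n + m \<ge> 0" using \<epsilon> by (simp add: m_def)
      with size_M have L_le: "real L \<le> 1 + m + m * \<epsilon> * real n"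
        unfolding L_def by linarith
      have "real (CARD('d action) * (C * L)) = D * real C * real L"
        by (simp only: D_def of_nat_mult mult.assoc)
      also have "\<dots> \<le> D * real C * (1 + m + m * \<epsilon> * real n)"
        using L_le by (intro mult_left_mono) (auto simp: D_def)
      also have "\<dots> = D * real C * (1 + m) + \<epsilon> * (1 + D * real C * m) * real n - \<epsilon> * real n"
        by (simp add: algebra_simps)
      also have "\<epsilon> * (1 + D * real C * m) = p / 2"
        using D by (simp add: \<epsilon>_def field_simps)
      also have "D * real C * (1 + m) + p / 2 * real n - \<epsilon> * real n < (p - \<epsilon>) * real n - 1"
        using False p(1) by (simp add: n0_def field_simps)
      also have "\<dots> \<le> (pmf F \<theta> - \<epsilon>) * real n - 1"
        using p(2)[OF \<theta>] by (intro diff_right_mono mult_right_mono) auto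
      also have "\<dots> \<le> real (count M \<theta>)"
        using N_ge \<theta> by (simp add: M(1))
      finally have large: "CARD('d action) * (C * L) < count M \<theta>" by linarith
      obtain a where feas: "feasible b a" and a: "\<And>\<theta>s. set \<theta>s \<subseteq> R \<Longrightarrow> M \<subseteq># mset (\<theta> # \<theta>s) \<Longrightarrow>
          size (mset (\<theta> # \<theta>s) - M) \<le> L \<Longrightarrow>
          V_hs b (\<theta> # \<theta>s) \<le> reward \<theta> a + V_hs (b - cost a) \<theta>s"
        using robust_action[OF R(1) M(2) \<theta> b C large] by blast
      define bad where "bad = {\<theta>s. \<exists>r\<in>R. real (count (mset \<theta>s) r) < (pmf F r - \<epsilon>) * real n}"
      have good: "V_hs b (\<theta> # \<theta>s) \<le> reward \<theta> a + V_hs (b - cost a) \<theta>s"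
        if "set \<theta>s \<subseteq> R" "length \<theta>s = n" "\<theta>s \<notin> bad" for \<theta>s
      proof (rule a[OF that(1)])
        have "N r \<le> count (mset \<theta>s) r" if "r \<in> R" for r
        proof -
          have "(pmf F r - \<epsilon>) * real n \<le> real (count (mset \<theta>s) r)"
            using \<open>\<theta>s \<notin> bad\<close> that unfolding bad_def by (auto simp: not_less)
          then show ?thesis unfolding N_def by linarith
        qed
        then show sub: "M \<subseteq># mset (\<theta> # \<theta>s)"
          by (auto simp: subseteq_mset_def M(1) le_SucI)
        show "size (mset (\<theta> # \<theta>s) - M) \<le> L"
          using that(2) unfolding size_Diff_submset[OF sub] L_def by simp
      qed
      have "V_hs b (\<theta> # \<theta>s) \<le> reward \<theta> a + V_hs (b - cost a) \<theta>s + 2 * indicator bad \<theta>s"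
        if "\<theta>s \<in> set_pmf (replicate_pmf n F)" for \<theta>s
        using good[of \<theta>s] decision_loss_le_2[OF feas unit'[OF that]] that
        by (cases "\<theta>s \<in> bad") (auto simp: in_set_replicate_pmf R_def)
      then have "expect (replicate_pmf n F) (\<lambda>\<theta>s. V_hs b (\<theta> # \<theta>s)) \<le>
          expect (replicate_pmf n F) (\<lambda>\<theta>s. reward \<theta> a + V_hs (b - cost a) \<theta>s + 2 * indicator bad \<theta>s)"
        by (intro expect_mono fin')
      also have "\<dots> = reward \<theta> a + expect (replicate_pmf n F) (V_hs (b - cost a)) +
          2 * measure_pmf.prob (replicate_pmf n F) bad"
        unfolding reward_out by simp
      also have "measure_pmf.prob (replicate_pmf n F) bad \<le> m * \<rho> ^ n"
        using atypical_counts_prob[OF fin, of \<epsilon> n] \<epsilon> unfolding bad_def m_def \<rho>_def R_def by simp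
      also have "2 * (m * \<rho> ^ n) \<le> G * \<rho> ^ n"
        using \<rho> by (simp add: G_def mult_right_mono mult.assoc[symmetric])
      finally show ?thesis using feas by (intro exI[of _ a]) simp
    qed
  qed
  with \<rho> show ?thesis unfolding R_def by blast
qed

lemma rams_score_diff:
  assumes "K > 0"
  shows "rams_score K b \<theta> \<omega> a - rams_score K b \<theta> \<omega> a' =
    reward \<theta> a + 1 / real K * (\<Sum>i<K. V_hs (b - cost a) (\<omega> ! i) - V_hs b (\<omega> ! i)) -
    (reward \<theta> a' + 1 / real K * (\<Sum>i<K. V_hs (b - cost a') (\<omega> ! i) - V_hs b (\<omega> ! i)))"
  using assms by (simp add: rams_score_def sum.distrib sum_subtractf field_simps)

text \<open>
  The selected action beats \<open>a\<close> in the simulation, so it can be worse than \<open>a\<close> in expectation only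
  by the sampling errors of the two. Which action is selected depends on the samples; therefore the
  errors of all feasible actions are added up.
\<close>
lemma rams_decision_loss:
  fixes F :: "'d::finite request pmf" and \<theta> :: "'d request"
  assumes fin: "finite (set_pmf F)"
    and unit: "\<And>r k. r \<in> set_pmf F \<Longrightarrow> 0 \<le> r $ k \<and> r $ k \<le> 1"
    and K: "K > 0"
    and \<sigma>: "\<And>\<omega>. set_pmf (\<sigma> \<omega>) \<subseteq> {a. is_arg_max (rams_score K b \<theta> \<omega>) (feasible b) a}"
    and a: "feasible b a"
  shows "reward \<theta> a + expect (replicate_pmf n F) (V_hs (b - cost a)) \<le>
    expect (bind_pmf (replicate_pmf K (replicate_pmf n F)) \<sigma>)
      (\<lambda>a'. reward \<theta> a' + expect (replicate_pmf n F) (V_hs (b - cost a'))) +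
    2 * real CARD('d action) / sqrt (real K)"
proof -
  define P where "P = replicate_pmf n F"
  define q where "q a' = reward \<theta> a' + expect P (V_hs (b - cost a'))" for a'
  \<comment> \<open>subtracting the value of the unreduced budget keeps the summands bounded uniformly in the horizon\<close>
  define \<Delta> where "\<Delta> a' \<theta>s = V_hs (b - cost a') \<theta>s - V_hs b \<theta>s" for a' \<theta>s
  define err where "err a' \<omega> = \<bar>1 / real K * (\<Sum>i<K. \<Delta> a' (\<omega> ! i)) - expect P (\<Delta> a')\<bar>" for a' \<omega>
  define Err where "Err \<omega> = (\<Sum>a' | feasible b a'. err a' \<omega>)" for \<omega>
  have finP: "finite (set_pmf P)" unfolding P_def by (rule finite_set_replicate_pmf[OF fin])
  note finK = finite_set_replicate_pmf[OF finP, of K]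
  have q_eq: "q a' = reward \<theta> a' + expect P (\<Delta> a') + expect P (V_hs b)" for a'
    unfolding q_def \<Delta>_def by (simp add: expect_diff[OF finP])
  have err_le: "err a' \<omega> \<le> Err \<omega>" if "feasible b a'" for a' \<omega>
    unfolding Err_def using that by (intro member_le_sum) (auto simp: err_def)
  have pointwise: "q a - 2 * Err \<omega> \<le> q a'" if "a' \<in> set_pmf (\<sigma> \<omega>)" for a' \<omega>
  proof -
    have "feasible b a'" "rams_score K b \<theta> \<omega> a \<le> rams_score K b \<theta> \<omega> a'"
      using \<sigma>[of \<omega>] that a by (auto simp: is_arg_max_def not_less)
    with rams_score_diff[OF K, of b \<theta> \<omega> a a'] err_le[of a' \<omega>] err_le[OF a, of \<omega>]
    show ?thesis unfolding q_eq err_def \<Delta>_def by linarith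
  qed
  have "expect (replicate_pmf K P) Err = (\<Sum>a' | feasible b a'. expect (replicate_pmf K P) (err a'))"
    unfolding Err_def by (rule expect_sum[OF finK])
  also have "\<dots> \<le> (\<Sum>a' | feasible b a'. 1 / sqrt (real K))"
  proof (rule sum_mono)
    fix a' assume "a' \<in> {a'. feasible b a'}"
    then have feas: "feasible b a'" by simp
    have "\<bar>\<Delta> a' \<theta>s\<bar> \<le> 1" if "\<theta>s \<in> set_pmf P" for \<theta>s
    proof -
      have "\<forall>r \<in> set \<theta>s. \<forall>k. 0 \<le> r $ k \<and> r $ k \<le> 1"
        using that unit unfolding P_def in_set_replicate_pmf by blast
      from V_hs_budget_bounds[OF feas this] show ?thesis unfolding \<Delta>_def by auto
    qed
    from sample_mean_error[OF finP this K]
    show "expect (replicate_pmf K P) (err a') \<le> 1 / sqrt (real K)"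
      unfolding err_def .
  qed
  also have "\<dots> = real (card {a'. feasible b a'}) * (1 / sqrt (real K))"
    by simp
  also have "\<dots> \<le> real CARD('d action) * (1 / sqrt (real K))"
    by (intro mult_right_mono of_nat_mono card_mono) auto
  finally have Err: "expect (replicate_pmf K P) Err \<le> real CARD('d action) / sqrt (real K)"
    by simp
  have "q a - 2 * expect (replicate_pmf K P) Err = expect (replicate_pmf K P) (\<lambda>\<omega>. q a - 2 * Err \<omega>)"
    by (simp add: expect_diff[OF finK])
  also have "\<dots> \<le> expect (replicate_pmf K P) (\<lambda>\<omega>. expect (\<sigma> \<omega>) q)"
  proof (intro expect_mono finK)
    fix \<omega>
    have "expect (\<sigma> \<omega>) (\<lambda>_. q a - 2 * Err \<omega>) \<le> expect (\<sigma> \<omega>) q"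
      using pointwise by (intro expect_mono) auto
    then show "q a - 2 * Err \<omega> \<le> expect (\<sigma> \<omega>) q" by simp
  qed
  also have "\<dots> = expect (bind_pmf (replicate_pmf K P) \<sigma>) q"
    using finK by (subst expect_bind) auto
  finally have "q a - 2 * expect (replicate_pmf K P) Err \<le> expect (bind_pmf (replicate_pmf K P) \<sigma>) q" .
  with Err have "q a \<le> expect (bind_pmf (replicate_pmf K P) \<sigma>) q + 2 * (real CARD('d action) / sqrt (real K))"
    by linarith
  then show ?thesis unfolding q_def P_def by simp
qed

section \<open>From decision losses to regret\<close>

lemma remaining_snoc: "remaining B (h @ [(\<theta>, a)]) = remaining B h - cost a"
  by (simp add: remaining_def)

lemma run_invariant:
  fixes F :: "'d::finite request pmf"
  assumes "finite (set_pmf F)" "0 \<le> B" "m \<le> T"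
    and \<pi>: "\<And>h \<theta>. length h < T \<Longrightarrow> 0 \<le> remaining B h \<Longrightarrow> \<theta> \<in> set_pmf F \<Longrightarrow>
      set_pmf (\<pi> h \<theta>) \<subseteq> Collect (feasible (remaining B h))"
  shows "finite (set_pmf (run F \<pi> m)) \<and>
    (\<forall>h \<in> set_pmf (run F \<pi> m). length h = m \<and> 0 \<le> remaining B h)"
  using assms(3)
proof (induction m)
  case 0
  with assms(2) show ?case by (simp add: remaining_def)
next
  case (Suc m)
  then have m: "m < T" and fin: "finite (set_pmf (run F \<pi> m))"
    and IH: "\<And>h. h \<in> set_pmf (run F \<pi> m) \<Longrightarrow> length h = m \<and> 0 \<le> remaining B h"
    by auto
  have "length h = Suc m \<and> 0 \<le> remaining B h" if "h \<in> set_pmf (run F \<pi> (Suc m))" for h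
  proof -
    from that obtain h' \<theta> a where h': "h' \<in> set_pmf (run F \<pi> m)" "\<theta> \<in> set_pmf F"
      and a: "a \<in> set_pmf (\<pi> h' \<theta>)" and h: "h = h' @ [(\<theta>, a)]"
      by auto
    have "feasible (remaining B h') a"
      using \<pi>[of h' \<theta>] IH[OF h'(1)] h'(2) a m by blast
    with IH[OF h'(1)] show ?thesis by (simp add: h remaining_snoc feasible_def)
  qed
  moreover have "finite (set_pmf (run F \<pi> (Suc m)))"
    using fin assms(1) by simp
  ultimately show ?case by blast
qed

text \<open>
  Interpolate between the hindsight optimum and the policy: \<open>W m\<close> is the expected reward of
  following \<open>\<pi>\<close> for \<open>m\<close> periods and the hindsight optimum afterwards. Each period in which the
  policy takes over loses at most \<open>\<psi> n\<close>, with \<open>n\<close> periods still to come.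
\<close>
lemma regret_le_sum_decision_losses:
  fixes F :: "'d::finite request pmf"
  assumes fin: "finite (set_pmf F)" and B: "0 \<le> B"
    and \<pi>: "\<And>h \<theta>. length h < T \<Longrightarrow> 0 \<le> remaining B h \<Longrightarrow> \<theta> \<in> set_pmf F \<Longrightarrow>
      set_pmf (\<pi> h \<theta>) \<subseteq> Collect (feasible (remaining B h))"
    and loss: "\<And>h \<theta> n. T = Suc (length h) + n \<Longrightarrow> 0 \<le> remaining B h \<Longrightarrow> \<theta> \<in> set_pmf F \<Longrightarrow>
      expect (replicate_pmf n F) (\<lambda>\<theta>s. V_hs (remaining B h) (\<theta> # \<theta>s)) \<le>
      expect (\<pi> h \<theta>) (\<lambda>a. reward \<theta> a + expect (replicate_pmf n F) (V_hs (remaining B h - cost a))) + \<psi> n"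
  shows "regret F B T \<pi> \<le> (\<Sum>n<T. \<psi> n)"
proof -
  define earned :: "'d history \<Rightarrow> real" where "earned h = (\<Sum>(\<theta>, a)\<leftarrow>h. reward \<theta> a)" for h
  define W where "W m = expect (run F \<pi> m) (\<lambda>h. earned h +
    expect (replicate_pmf (T - m) F) (V_hs (remaining B h)))" for m
  have inv: "finite (set_pmf (run F \<pi> m)) \<and>
      (\<forall>h \<in> set_pmf (run F \<pi> m). length h = m \<and> 0 \<le> remaining B h)" if "m \<le> T" for m
    using that by (rule run_invariant[OF fin B]) (rule \<pi>)
  have step: "W m \<le> W (Suc m) + \<psi> (T - Suc m)" if "m < T" for m
  proof -
    define n where "n = T - Suc m"
    have T: "T - m = Suc n" "T - Suc m = n" "T = Suc m + n" using that by (auto simp: n_def)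
    have inv_m: "finite (set_pmf (run F \<pi> m))"
      "\<And>h. h \<in> set_pmf (run F \<pi> m) \<Longrightarrow> length h = m \<and> 0 \<le> remaining B h"
      using inv[of m] that by auto
    have "W m \<le> expect (run F \<pi> m) (\<lambda>h. expect F (\<lambda>\<theta>. expect (\<pi> h \<theta>) (\<lambda>a.
        earned (h @ [(\<theta>, a)]) + expect (replicate_pmf n F) (V_hs (remaining B (h @ [(\<theta>, a)]))))) + \<psi> n)"
      unfolding W_def T(1)
    proof (intro expect_mono inv_m(1))
      fix h assume "h \<in> set_pmf (run F \<pi> m)"
      with inv_m(2) have h: "length h = m" "0 \<le> remaining B h" by auto
      have "earned h + expect (replicate_pmf (Suc n) F) (V_hs (remaining B h)) =
          expect F (\<lambda>\<theta>. earned h + expect (replicate_pmf n F) (\<lambda>\<theta>s. V_hs (remaining B h) (\<theta> # \<theta>s)))"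
        unfolding expect_replicate_Suc[OF fin] by (simp add: expect_add[OF fin])
      also have "\<dots> \<le> expect F (\<lambda>\<theta>. expect (\<pi> h \<theta>) (\<lambda>a.
          earned (h @ [(\<theta>, a)]) + expect (replicate_pmf n F) (V_hs (remaining B (h @ [(\<theta>, a)])))) + \<psi> n)"
      proof (intro expect_mono fin)
        fix \<theta> assume "\<theta> \<in> set_pmf F"
        from loss[of h n, OF _ h(2) this] h(1) T
        have "earned h + expect (replicate_pmf n F) (\<lambda>\<theta>s. V_hs (remaining B h) (\<theta> # \<theta>s)) \<le>
            expect (\<pi> h \<theta>) (\<lambda>a. earned h + (reward \<theta> a +
              expect (replicate_pmf n F) (V_hs (remaining B h - cost a)))) + \<psi> n"
          by (subst expect_add) auto
        then show "earned h + expect (replicate_pmf n F) (\<lambda>\<theta>s. V_hs (remaining B h) (\<theta> # \<theta>s)) \<le>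
            expect (\<pi> h \<theta>) (\<lambda>a. earned (h @ [(\<theta>, a)]) +
              expect (replicate_pmf n F) (V_hs (remaining B (h @ [(\<theta>, a)])))) + \<psi> n"
          by (simp add: earned_def remaining_snoc add.assoc)
      qed
      finally show "earned h + expect (replicate_pmf (Suc n) F) (V_hs (remaining B h)) \<le>
          expect F (\<lambda>\<theta>. expect (\<pi> h \<theta>) (\<lambda>a. earned (h @ [(\<theta>, a)]) +
            expect (replicate_pmf n F) (V_hs (remaining B (h @ [(\<theta>, a)]))))) + \<psi> n"
        by (simp add: expect_add[OF fin])
    qed
    also have "\<dots> = W (Suc m) + \<psi> n"
      unfolding W_def T(2) by (simp add: expect_add[OF inv_m(1)] expect_bind inv_m(1) fin)
    finally show ?thesis unfolding T(2) .
  qed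
  have "W 0 \<le> W m + (\<Sum>i<m. \<psi> (T - Suc i))" if "m \<le> T" for m
    using that
  proof (induction m)
    case (Suc m)
    with step[of m] show ?case by simp
  qed simp
  from this[of T] have "W 0 \<le> W T + (\<Sum>n<T. \<psi> n)"
    by (simp add: sum.nat_diff_reindex)
  moreover have "W 0 = expect (replicate_pmf T F) (V_hs B)"
    by (simp add: W_def earned_def remaining_def)
  moreover have "W T = expect (run F \<pi> T) earned"
    unfolding W_def using inv[of T] by (intro expect_cong) (simp add: V_hs_Nil)
  ultimately show ?thesis
    unfolding regret_def earned_def by simp
qed

theorem mainTheorem9:
  fixes F :: "(real ^ 'd::finite) pmf" and \<eta> \<nu> :: real
  assumes "finite (set_pmf F)"
    and "\<And>r k. r \<in> set_pmf F \<Longrightarrow> 0 \<le> r $ k \<and> r $ k \<le> 1"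
    and "\<eta> > 2" and "\<nu> > 0"
  shows "\<exists>C::real. \<forall>(T::nat) (B::real ^ 'd) (K::nat \<Rightarrow> nat) \<sigma>.
    0 \<le> B \<longrightarrow>
    (\<forall>t\<in>{1..T}. real (K t) \<ge> real (T - t + 1) powr (\<eta> + \<nu>)) \<longrightarrow>
    rams_selection B K \<sigma> \<longrightarrow>
    regret F B T (rams F T K \<sigma>) \<le> C"
proof -
  obtain G \<rho> where \<rho>: "0 < \<rho>" "\<rho> < 1"
    and near: "\<And>n b \<theta>. 0 \<le> b \<Longrightarrow> \<theta> \<in> set_pmf F \<Longrightarrow> \<exists>a. feasible b a \<and>
      expect (replicate_pmf n F) (\<lambda>\<theta>s. V_hs b (\<theta> # \<theta>s)) \<le>
      reward \<theta> a + expect (replicate_pmf n F) (V_hs (b - cost a)) + G * \<rho> ^ n"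
    using near_optimal_action[OF assms(1,2)] by blast
  define D where "D = 2 * real CARD('d action)"
  define \<psi> where "\<psi> n = max 0 G * \<rho> ^ n + D * real (Suc n) powr (- (\<eta> + \<nu>) / 2)" for n
  have \<psi>_nonneg: "\<psi> n \<ge> 0" for n
    using \<rho> by (simp add: \<psi>_def D_def)
  have "summable (\<lambda>n. real (Suc n) powr (- (\<eta> + \<nu>) / 2))"
    using assms(3,4) by (subst summable_Suc_iff) (simp add: summable_real_powr_iff)
  then have \<psi>: "summable \<psi>"
    unfolding \<psi>_def using \<rho> by (intro summable_add summable_mult summable_geometric) auto
  have "regret F B T (rams F T K \<sigma>) \<le> suminf \<psi>"
    if B: "0 \<le> B" and K: "\<forall>t\<in>{1..T}. real (K t) \<ge> real (T - t + 1) powr (\<eta> + \<nu>)"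
      and sel: "rams_selection B K \<sigma>" for T B K \<sigma>
  proof -
    have arg_max: "set_pmf (\<sigma> h \<theta> \<omega>) \<subseteq>
        {a. is_arg_max (rams_score (K (Suc (length h))) (remaining B h) \<theta> \<omega>) (feasible (remaining B h)) a}"
      if "0 \<le> remaining B h" for h \<theta> \<omega>
      using sel that unfolding rams_selection_def by blast
    have "regret F B T (rams F T K \<sigma>) \<le> (\<Sum>n<T. \<psi> n)"
    proof (rule regret_le_sum_decision_losses[OF assms(1) B])
      fix h :: "'d history" and \<theta> :: "'d request"
      assume "0 \<le> remaining B h"
      from arg_max[OF this] show "set_pmf (rams F T K \<sigma> h \<theta>) \<subseteq> Collect (feasible (remaining B h))"
        by (fastforce simp: rams_def Let_def is_arg_max_def)
    next
      fix h :: "'d history" and \<theta> :: "'d request" and n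
      assume T: "T = Suc (length h) + n" and b: "0 \<le> remaining B h" and \<theta>: "\<theta> \<in> set_pmf F"
      let ?t = "Suc (length h)"
      have K_ge: "real (Suc n) powr (\<eta> + \<nu>) \<le> real (K ?t)"
        using bspec[OF K, of ?t] T by (simp add: add.commute)
      have pos: "real (Suc n) powr (\<eta> + \<nu>) > 0" by simp
      with K_ge have K_pos: "K ?t > 0" by (metis of_nat_0_less_iff order_less_le_trans)
      obtain a where a: "feasible (remaining B h) a"
        "expect (replicate_pmf n F) (\<lambda>\<theta>s. V_hs (remaining B h) (\<theta> # \<theta>s)) \<le>
        reward \<theta> a + expect (replicate_pmf n F) (V_hs (remaining B h - cost a)) + G * \<rho> ^ n"
        using near[OF b \<theta>] by blast
      note a(2)
      also have "reward \<theta> a + expect (replicate_pmf n F) (V_hs (remaining B h - cost a)) \<le>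
          expect (rams F T K \<sigma> h \<theta>)
            (\<lambda>a. reward \<theta> a + expect (replicate_pmf n F) (V_hs (remaining B h - cost a))) +
          D / sqrt (real (K ?t))"
        using rams_decision_loss[OF assms(1,2) K_pos arg_max[OF b] a(1), where n = n] T
        by (simp add: rams_def Let_def D_def)
      also have "D / sqrt (real (K ?t)) \<le> D / sqrt (real (Suc n) powr (\<eta> + \<nu>))"
        using K_ge pos K_pos by (intro divide_left_mono) (auto simp: D_def)
      also have "\<dots> = D * real (Suc n) powr (- (\<eta> + \<nu>) / 2)"
        unfolding minus_divide_left[symmetric] powr_minus_divide
        by (simp add: powr_half_sqrt[symmetric] powr_powr)
      also have "G * \<rho> ^ n \<le> max 0 G * \<rho> ^ n"
        using \<rho> by (intro mult_right_mono) auto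
      finally show "expect (replicate_pmf n F) (\<lambda>\<theta>s. V_hs (remaining B h) (\<theta> # \<theta>s)) \<le>
          expect (rams F T K \<sigma> h \<theta>)
            (\<lambda>a. reward \<theta> a + expect (replicate_pmf n F) (V_hs (remaining B h - cost a))) + \<psi> n"
        by (simp add: \<psi>_def)
    qed
    also have "\<dots> \<le> suminf \<psi>"
      using \<psi> \<psi>_nonneg by (intro sum_le_suminf) auto
    finally show ?thesis .
  qed
  then show ?thesis by blast
qed

end
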